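(* Let $\eta>0$ and $r>0$. There exists an integer $n_0=n_0(\eta,r)\ge 1$, depending only on $\eta$ and $r$, such that the following holds for every integer $n\ge n_0$ and every $p$ (possibly depending on $n$) satisfying $$\frac{(\log n)^2}{\sqrt n}\le p\le 1-\frac{(\log n)^2}{\sqrt n}.$$ Let $H=G(n,p)$ and let $E_{edit}=E_{edit}(\eta)$ be the event that all three Eulerian numbers $N_{edit}(H)$, $N_{ext}(H)$ and $N_{red}(H)$ lie between $\frac n4-n^{\frac12+\eta}$ and $\frac n4+n^{\frac12+\eta}$. Then $$\mathbb P(E_{edit})\ge 1-\frac1{n^{r}}.$$
   Context: All graphs are finite and simple; $\log$ is the natural logarithm. $G(n,p)$ is the random graph on vertex set $\{1,\dots,n\}$ in which each edge of the complete graph $K_n$ is present with probability $p$, independently of the other edges. A sequence of vertices $(u_1,\dots,u_t)$, $t\ge 3$, is a circuit in a graph $G$ if $u_i$ is adjacent to $u_{i+1}$ for $1\le i\le t-1$ and $u_t$ is adjacent to $u_1$; it is an Eulerian circuit if each edge of $G$ occurs exactly once in it. $G$ is Eulerian if it contains an Eulerian circuit; by convention an Eulerian graph is connected (on its whole vertex set) and has at least three edges. Thus a graph with at least one edge is Eulerian if and only if it is connected and every vertex has even degree. All edge operations keep the vertex set fixed and produce simple graphs. Edit number: a $1$-edit graph of $G$ is a graph obtained from $G$ by adding or removing a single edge; for $i\ge1$, an $(i+1)$-edit graph of $G$ is a $1$-edit graph of an $i$-edit graph of $G$; the $0$-edit graph of $G$ is $G$ itself. $N_{edit}(G)$ is the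 smallest integer $k\ge0$ such that some $k$-edit graph of $G$ is Eulerian. Extension number: $G$ is Eulerian extendable if it can be converted into an Eulerian graph by adding a finite number of edges; for such $G$, $N_{ext}(G)$ is the minimum number of edges that must be added to $G$ so that the resulting graph is Eulerian. Reduction number: $G$ is Eulerian reducable if it can be converted into an Eulerian graph containing at least one edge by removing a finite number of edges; for such $G$, $N_{red}(G)$ is the minimum number of edges that must be removed from $G$ so that the resulting graph is Eulerian. Since $N_{ext}(H)$ and $N_{red}(H)$ are defined only when $H$ is Eulerian extendable, respectively Eulerian reducable, the event $E_{edit}$ is understood to include that $H$ is both Eulerian extendable and Eulerian reducable. *)

theory Defs
  imports "HOL-Probability.Probability" "HOL-Probability.Product_PMF"
begin

text \<open>
  A finite simple graph is given by its finite vertex set \<open>V\<close> and its edge set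
  \<open>E \<subseteq> all_edges V\<close>, an edge being the two-element set of its end points. All edge
  operations below act on \<open>E\<close> and leave \<open>V\<close> unchanged.
\<close>

definition all_edges :: "'a set \<Rightarrow> 'a set set" where
  "all_edges V = {e. e \<subseteq> V \<and> card e = 2}"

definition connected_graph :: "'a set \<Rightarrow> 'a set set \<Rightarrow> bool" where
  "connected_graph V E \<longleftrightarrow> (\<forall>u\<in>V. \<forall>v\<in>V. (u, v) \<in> {(x, y). {x, y} \<in> E}\<^sup>*)"

text \<open>
  Positions in a vertex sequence are counted from 0; the step from the last position
  leads back to the first vertex.
\<close>

definition circuit_step :: "'a list \<Rightarrow> nat \<Rightarrow> 'a set" where
  "circuit_step us i = {us ! i, us ! (Suc i mod length us)}"

definition circuit :: "'a set set \<Rightarrow> 'a list \<Rightarrow> bool" where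
  "circuit E us \<longleftrightarrow> 3 \<le> length us \<and> (\<forall>i<length us. circuit_step us i \<in> E)"

definition eulerian_circuit :: "'a set set \<Rightarrow> 'a list \<Rightarrow> bool" where
  "eulerian_circuit E us \<longleftrightarrow>
     circuit E us \<and> (\<forall>e\<in>E. \<exists>!i. i < length us \<and> circuit_step us i = e)"

definition eulerian :: "'a set \<Rightarrow> 'a set set \<Rightarrow> bool" where
  "eulerian V E \<longleftrightarrow>
     connected_graph V E \<and> 3 \<le> card E \<and> (\<exists>us. eulerian_circuit E us)"

definition one_edit :: "'a set \<Rightarrow> 'a set set \<Rightarrow> 'a set set \<Rightarrow> bool" where
  "one_edit V E E' \<longleftrightarrow>
     (\<exists>e \<in> all_edges V - E. E' = insert e E) \<or> (\<exists>e\<in>E. E' = E - {e})"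

primrec edit_graph :: "'a set \<Rightarrow> nat \<Rightarrow> 'a set set \<Rightarrow> 'a set set \<Rightarrow> bool" where
  "edit_graph V 0 E E' \<longleftrightarrow> E' = E"
| "edit_graph V (Suc i) E E' \<longleftrightarrow> (\<exists>E''. edit_graph V i E E'' \<and> one_edit V E'' E')"

text \<open>
  The three numbers below are meaningful only if the set being minimised over is nonempty.
  For \<open>N_ext\<close> and \<open>N_red\<close> this is \<open>eulerian_extendable\<close> and \<open>eulerian_reducable\<close>; for
  \<open>N_edit\<close> and a finite simple graph it holds as soon as \<open>V\<close> has at least three elements, and in
  particular whenever the graph is extendable.
\<close>

definition N_edit :: "'a set \<Rightarrow> 'a set set \<Rightarrow> nat" where
  "N_edit V E = (LEAST k. \<exists>E'. edit_graph V k E E' \<and> eulerian V E')"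

definition extends_to_eulerian :: "'a set \<Rightarrow> 'a set set \<Rightarrow> 'a set set \<Rightarrow> bool" where
  "extends_to_eulerian V E F \<longleftrightarrow>
     finite F \<and> F \<subseteq> all_edges V - E \<and> eulerian V (E \<union> F)"

definition eulerian_extendable :: "'a set \<Rightarrow> 'a set set \<Rightarrow> bool" where
  "eulerian_extendable V E \<longleftrightarrow> (\<exists>F. extends_to_eulerian V E F)"

definition N_ext :: "'a set \<Rightarrow> 'a set set \<Rightarrow> nat" where
  "N_ext V E = (LEAST k. \<exists>F. extends_to_eulerian V E F \<and> card F = k)"

definition reduces_to_eulerian :: "'a set \<Rightarrow> 'a set set \<Rightarrow> 'a set set \<Rightarrow> bool" where
  "reduces_to_eulerian V E F \<longleftrightarrow>
     finite F \<and> F \<subseteq> E \<and> E - F \<noteq> {} \<and> eulerian V (E - F)"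

definition eulerian_reducable :: "'a set \<Rightarrow> 'a set set \<Rightarrow> bool" where
  "eulerian_reducable V E \<longleftrightarrow> (\<exists>F. reduces_to_eulerian V E F)"

definition N_red :: "'a set \<Rightarrow> 'a set set \<Rightarrow> nat" where
  "N_red V E = (LEAST k. \<exists>F. reduces_to_eulerian V E F \<and> card F = k)"

text \<open>The law of the edge set of \<open>G(n,p)\<close>.\<close>

definition gnp :: "nat \<Rightarrow> real \<Rightarrow> nat set set pmf" where
  "gnp n p = map_pmf (\<lambda>X. {e \<in> all_edges {1..n}. X e})
     (Pi_pmf (all_edges {1..n}) False (\<lambda>_. bernoulli_pmf p))"

definition near_quarter :: "real \<Rightarrow> nat \<Rightarrow> nat \<Rightarrow> bool" where
  "near_quarter \<eta> n k \<longleftrightarrow>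
     real n / 4 - real n powr (1 / 2 + \<eta>) \<le> real k \<and>
     real k \<le> real n / 4 + real n powr (1 / 2 + \<eta>)"

definition E_edit :: "real \<Rightarrow> nat \<Rightarrow> nat set set set" where
  "E_edit \<eta> n = {E. eulerian_extendable {1..n} E \<and> eulerian_reducable {1..n} E \<and>
     near_quarter \<eta> n (N_edit {1..n} E) \<and>
     near_quarter \<eta> n (N_ext {1..n} E) \<and>
     near_quarter \<eta> n (N_red {1..n} E)}"

end

theory Submission
  imports Defs "HOL-Real_Asymp.Real_Asymp"
begin

text \<open>
  Let \<open>T\<close> be the set of vertices of odd degree. One edit changes the parity of two vertices, so each of
  the three numbers is at least \<open>|T| / 2\<close>. For the upper bounds, choose in \<open>E\<close> (respectively in its
  complement) a maximal matching on \<open>T\<close>, join the few unmatched vertices in pairs by paths of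
  length two, and remove (respectively add) the symmetric difference of all these edges; no
  disjointness of the paths is needed. This works as soon as every set of \<open>s = \<lceil>sqrt n\<rceil>\<close>
  vertices contains an edge and a non-edge, any two vertices have three common neighbours and three
  common non-neighbours, and the degrees exceed \<open>3 s + 4\<close>; it costs \<open>|T| / 2 + s\<close> edges. These
  properties follow from union bounds. Finally the degree parities are nearly independent: the
  expected product of the signs \<open>(-1) ^ deg v\<close> over \<open>v \<in> S\<close> is \<open>(1 - 2p)\<close> to the power
  \<open>|S| (n - |S|)\<close>, which makes \<open>|T|\<close> concentrate around \<open>n / 2\<close>.
\<close>

section \<open>Degree parity and Euler's theorem\<close>

definition deg :: "'a set set \<Rightarrow> 'a \<Rightarrow> nat" where
  "deg E v = card {e \<in> E. v \<in> e}"

definition odd_vertices :: "'a set \<Rightarrow> 'a set set \<Rightarrow> 'a set" where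
  "odd_vertices V E = {v \<in> V. odd (deg E v)}"

lemma finite_all_edges: "finite V \<Longrightarrow> finite (all_edges V)"
  unfolding all_edges_def by (rule finite_subset[of _ "Pow V"]) auto

lemma doubleton_in_all_edges: "{u, v} \<in> all_edges V \<longleftrightarrow> u \<in> V \<and> v \<in> V \<and> u \<noteq> v"
  by (cases "u = v") (auto simp: all_edges_def)

section \<open>Trails, and Euler's criterion by a longest trail\<close>

fun walk_edges :: "'a list \<Rightarrow> 'a set list" where
  "walk_edges (x # y # xs) = {x, y} # walk_edges (y # xs)"
| "walk_edges _ = []"

lemma length_walk_edges [simp]: "length (walk_edges xs) = length xs - 1"
  by (induction xs rule: walk_edges.induct) auto

lemma walk_edges_append:
  "walk_edges (xs @ a # ys) = walk_edges (xs @ [a]) @ walk_edges (a # ys)"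
  by (induction xs rule: walk_edges.induct) simp_all

lemma nth_walk_edges:
  "Suc i < length xs \<Longrightarrow> walk_edges xs ! i = {xs ! i, xs ! Suc i}"
proof (induction xs arbitrary: i rule: walk_edges.induct)
  case (1 x y xs)
  then show ?case by (cases i) auto
qed auto

definition trail :: "'a set set \<Rightarrow> 'a list \<Rightarrow> bool" where
  "trail E xs \<longleftrightarrow> xs \<noteq> [] \<and> distinct (walk_edges xs) \<and> set (walk_edges xs) \<subseteq> E"

text \<open>Each new first edge flips the parity of both its end points, which moves the odd end
  from \<open>y\<close> to \<open>x\<close>. The disequality of truth values is exclusive or, so the
  formula also covers closed walks, where the two ends cancel.\<close>

lemma odd_deg_walk_edges:
  assumes "xs \<noteq> []" "distinct (walk_edges xs)" "\<And>e. e \<in> set (walk_edges xs) \<Longrightarrow> card e = 2"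
  shows "odd (deg (set (walk_edges xs)) v) \<longleftrightarrow> (v = hd xs) \<noteq> (v = last xs)"
  using assms
proof (induction xs rule: walk_edges.induct)
  case (1 x y xs)
  let ?W = "set (walk_edges (y # xs))"
  have "x \<noteq> y" using 1(4)[of "{x,y}"] by (cases "x = y") auto
  have IH: "odd (deg ?W v) \<longleftrightarrow> (v = y) \<noteq> (v = last (y # xs))"
    using 1 by auto
  have "{e \<in> set (walk_edges (x # y # xs)). v \<in> e} =
      (if v = x \<or> v = y then insert {x,y} {e \<in> ?W. v \<in> e} else {e \<in> ?W. v \<in> e})"
    by auto
  moreover have "{x,y} \<notin> ?W" using 1(3) by simp
  ultimately have "deg (set (walk_edges (x # y # xs))) v =
      (if v = x \<or> v = y then Suc (deg ?W v) else deg ?W v)"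
    by (simp add: deg_def)
  then show ?case using IH \<open>x \<noteq> y\<close> by auto
qed (auto simp: deg_def)

text \<open>Re-rooting a closed trail at any of its vertices keeps its edges and its length, so a
  longest closed trail can be tested for extension at every vertex that it visits.\<close>

lemma trail_rotate:
  assumes "trail E (ys @ a # zs)" "hd (ys @ a # zs) = last (ys @ a # zs)"
  obtains xs where "trail E xs" "hd xs = a" "last xs = a"
    "set (walk_edges xs) = set (walk_edges (ys @ a # zs))"
    "length xs = length (ys @ a # zs)"
proof (cases ys)
  case Nil
  then show ?thesis using assms by (intro that[of "a # zs"]) auto
next
  case (Cons b bs)
  show ?thesis
  proof (cases zs rule: rev_cases)
    case Nil
    then show ?thesis
      using assms Cons by (intro that[of "ys @ [a]"]) auto
  next
    case (snoc cs c)
    have [simp]: "c = b" using assms(2) Cons snoc by simp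
    \<comment> \<open>The start \<open>b\<close> of the closed trail is listed at both ends; in the
      rotated list it appears once at the junction, while \<open>a\<close> is doubled
      instead.\<close>
    have eq: "walk_edges ((a # cs) @ b # (bs @ [a])) =
        walk_edges ((a # cs) @ [b]) @ walk_edges (b # (bs @ [a]))"
      by (rule walk_edges_append)
    have eq': "walk_edges (ys @ a # zs) = walk_edges (ys @ [a]) @ walk_edges (a # zs)"
      by (rule walk_edges_append)
    show ?thesis
    proof (rule that[of "(a # cs) @ b # (bs @ [a])"])
      show "trail E ((a # cs) @ b # bs @ [a])"
        using assms(1) unfolding trail_def eq eq' using Cons snoc by auto
      show "set (walk_edges ((a # cs) @ b # bs @ [a])) = set (walk_edges (ys @ a # zs))"
        unfolding eq eq' using Cons snoc by auto
    qed (use Cons snoc in auto)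
  qed
qed

lemma set_subset_Union_walk_edges:
  "2 \<le> length xs \<Longrightarrow> set xs \<subseteq> \<Union>(set (walk_edges xs))"
proof (induction xs rule: walk_edges.induct)
  case (1 x y xs)
  then show ?case by (cases xs) auto
qed auto

text \<open>A longest trail uses every edge at its end, so even degrees force it to close up. All
  its rotations are longest as well, so every edge at every visited vertex is used, and
  connectedness carries this to all of \<open>E\<close>.\<close>

lemma closed_trail_exhausts:
  assumes "finite E" "E \<subseteq> all_edges V" "connected_graph V E" "E \<noteq> {}" "odd_vertices V E = {}"
  obtains xs where "trail E xs" "hd xs = last xs" "set (walk_edges xs) = E"
proof -
  have len: "length xs \<le> card E + 1" if "trail E xs" for xs
  proof -
    have "card (set (walk_edges xs)) = length xs - 1"
      using that distinct_card[of "walk_edges xs"] by (simp add: trail_def)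
    then show ?thesis
      using card_mono[OF assms(1), of "set (walk_edges xs)"] that by (simp add: trail_def)
  qed
  have edge_card: "card e = 2" if "e \<in> E" for e using that assms(2) by (auto simp: all_edges_def)
  obtain e0 where "e0 \<in> E" using assms(4) by blast
  then obtain a0 where a0: "a0 \<in> e0" "a0 \<in> V"
    using assms(2) edge_card[of e0] by (fastforce simp: all_edges_def card_2_iff)
  \<comment> \<open>Every one-vertex list satisfies \<open>trail E\<close>, so membership in
    \<open>V\<close> is demanded separately; \<open>[a0]\<close> shows that there is a candidate,
    and \<open>len\<close> bounds the lengths.\<close>
  have "\<exists>xs. (trail E xs \<and> set xs \<subseteq> V) \<and> (\<forall>ys. trail E ys \<and> set ys \<subseteq> V \<longrightarrow> length ys \<le> length xs)"
    by (rule ex_has_greatest_nat[where k = "[a0]" and b = "card E + 2"])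
      (use len a0 in \<open>force simp: trail_def\<close>)+
  then obtain xs where xs: "trail E xs" "set xs \<subseteq> V"
    and max: "\<And>ys. trail E ys \<Longrightarrow> set ys \<subseteq> V \<Longrightarrow> length ys \<le> length xs" by blast
  have ne: "xs \<noteq> []" using xs by (simp add: trail_def)
  let ?W = "set (walk_edges xs)"
  have WE: "?W \<subseteq> E" using xs by (simp add: trail_def)
  \<comment> \<open>This is proved for all trails of maximal length, since \<open>absorb\<close>
    applies it to rotations of \<open>xs\<close>.\<close>
  have no_ext: "e \<in> set (walk_edges ys)"
    if ys: "trail E ys" "set ys \<subseteq> V" "length ys = length xs" and e: "e \<in> E" "last ys \<in> e" for ys e
  proof (rule ccontr)
    assume notin: "e \<notin> set (walk_edges ys)"
    obtain b where b: "e = {last ys, b}" "b \<noteq> last ys"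
      using edge_card[OF e(1)] e(2) by (auto simp: card_2_iff)
    have "b \<in> V" using b e(1) assms(2) by (auto simp: all_edges_def)
    obtain zs where zs: "ys = zs @ [last ys]"
      using ys(1) by (metis append_butlast_last_id trail_def)
    have "walk_edges (ys @ [b]) = walk_edges ys @ [e]"
      using walk_edges_append[of zs "last ys" "[b]"] zs b(1)
      by (metis append.assoc append_Cons append_Nil walk_edges.simps(1,3))
    then have "trail E (ys @ [b])" using ys(1) notin e(1) by (auto simp: trail_def)
    then show False using max[of "ys @ [b]"] ys \<open>b \<in> V\<close> by auto
  qed
  have closed: "hd xs = last xs"
  proof (rule ccontr)
    assume "hd xs \<noteq> last xs"
    then have "odd (deg ?W (last xs))"
      using odd_deg_walk_edges[of xs "last xs"] xs edge_card by (auto simp: trail_def)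
    moreover have "even (deg E (last xs))"
      using assms(5) xs(2) last_in_set[OF ne] unfolding odd_vertices_def by blast
    moreover have "{e \<in> ?W. last xs \<in> e} = {e \<in> E. last xs \<in> e}"
      using no_ext[OF xs refl] WE by auto
    ultimately show False by (simp add: deg_def)
  qed
  have absorb: "e \<in> ?W" if e: "e \<in> E" "a \<in> e" and a: "a \<in> set xs" for a e
  proof -
    obtain ys zs where sp: "xs = ys @ a # zs" using a by (meson split_list)
    obtain us where us: "trail E us" "hd us = a" "last us = a"
      "set (walk_edges us) = ?W" "length us = length xs"
      using trail_rotate[of E ys a zs] xs(1) closed sp by metis
    have "set us \<subseteq> V"
    proof (cases "length us \<ge> 2")
      case True
      have "\<Union>(set (walk_edges us)) \<subseteq> V"
        using us(4) WE assms(2) by (auto simp: all_edges_def)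
      then show ?thesis using set_subset_Union_walk_edges[OF True] by blast
    next
      case False
      then have "us = [a]" using us by (cases us; cases "tl us") (auto simp: trail_def)
      then show ?thesis using a xs(2) by auto
    qed
    then show ?thesis using no_ext[of us e] us e by auto
  qed
  have step: "y \<in> set xs" if "x \<in> set xs" "{x, y} \<in> E" for x y
  proof -
    have "{x,y} \<in> ?W" using absorb[of "{x,y}" x] that by simp
    then obtain i where "i < length (walk_edges xs)" "walk_edges xs ! i = {x,y}"
      by (auto simp: in_set_conv_nth)
    then have "y \<in> {xs ! i, xs ! Suc i}" "Suc i < length xs" using nth_walk_edges[of i xs] by auto
    then show ?thesis by auto
  qed
  have reach: "y \<in> set xs" if "(x, y) \<in> {(x, y). {x, y} \<in> E}\<^sup>*" "x \<in> set xs" for x y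
    using that by (induction rule: rtrancl_induct) (auto intro: step)
  have "E \<subseteq> ?W"
  proof
    fix e assume e: "e \<in> E"
    then obtain a where a: "a \<in> e" "a \<in> V"
      using assms(2) edge_card[of e] by (fastforce simp: all_edges_def card_2_iff)
    have "hd xs \<in> V" using ne xs(2) by (cases xs) auto
    then have "(hd xs, a) \<in> {(x, y). {x, y} \<in> E}\<^sup>*"
      using assms(3) a by (auto simp: connected_graph_def)
    then have "a \<in> set xs" using reach ne by auto
    then show "e \<in> ?W" using absorb e a by blast
  qed
  then show ?thesis using that xs closed WE by blast
qed

theorem eulerian_if_even:
  assumes "finite E" "E \<subseteq> all_edges V" "connected_graph V E" "3 \<le> card E" "odd_vertices V E = {}"
  shows "eulerian V E"
proof -
  have "E \<noteq> {}" using assms(4) by auto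
  then obtain xs where xs: "trail E xs" "hd xs = last xs" "set (walk_edges xs) = E"
    using closed_trail_exhausts[OF assms(1-3) _ assms(5)] by blast
  \<comment> \<open>A closed trail repeats its first vertex at the end, whereas
    \<open>circuit_step\<close> closes up through \<open>mod\<close>; hence the last entry is
    dropped.\<close>
  let ?us = "butlast xs"
  have dist: "distinct (walk_edges xs)" using xs by (simp add: trail_def)
  have len: "length xs - 1 = card E"
    using distinct_card[OF dist] xs(3) by simp
  have l: "length ?us = card E" using len by simp
  have step: "circuit_step ?us i = walk_edges xs ! i" if i: "i < card E" for i
  proof -
    have "walk_edges xs ! i = {xs ! i, xs ! Suc i}"
      using i len nth_walk_edges[of i xs] by simp
    moreover have "?us ! i = xs ! i" using i l by (simp add: nth_butlast)
    moreover have "?us ! (Suc i mod length ?us) = xs ! Suc i"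
    proof (cases "Suc i = card E")
      case True
      have "?us ! 0 = hd xs" using i l by (cases xs) (auto simp: nth_butlast hd_conv_nth)
      moreover have "xs ! Suc i = last xs"
        using True len i by (subst last_conv_nth) auto
      ultimately show ?thesis using True l xs(2) by simp
    next
      case False
      then show ?thesis using i l by (simp add: nth_butlast)
    qed
    ultimately show ?thesis by (simp add: circuit_step_def)
  qed
  have "circuit E ?us"
    unfolding circuit_def l using assms(4) step xs(3) len
    by (metis length_walk_edges nth_mem)
  moreover have "\<exists>!i. i < length ?us \<and> circuit_step ?us i = e" if "e \<in> E" for e
  proof -
    have "\<exists>!i. i < length (walk_edges xs) \<and> walk_edges xs ! i = e"
      using dist that xs(3) by (metis distinct_Ex1)
    then show ?thesis using step l len by (metis length_walk_edges)
  qed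
  ultimately show ?thesis
    using assms(3,4) unfolding eulerian_def eulerian_circuit_def by blast
qed

text \<open>Each visit of the circuit to a vertex uses one step arriving and one step leaving. These
  steps are all distinct, because edges are not repeated and there are no loops, so they pair up the
  edges at the vertex.\<close>

lemma odd_vertices_eulerian:
  assumes "E \<subseteq> all_edges V" "eulerian V E"
  shows "odd_vertices V E = {}"
proof -
  obtain us where us: "eulerian_circuit E us" using assms(2) by (auto simp: eulerian_def)
  define t where "t = length us"
  have t: "t \<ge> 3" and inE: "\<And>i. i < t \<Longrightarrow> circuit_step us i \<in> E"
    and ex1: "\<And>e. e \<in> E \<Longrightarrow> \<exists>!i. i < t \<and> circuit_step us i = e"
    using us by (auto simp: eulerian_circuit_def circuit_def t_def)
  have "even (deg E v)" for v
  proof -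
    \<comment> \<open>\<open>I\<close> indexes the steps that leave \<open>v\<close> and
      \<open>J\<close> those that arrive at it; the cyclic shift by one maps \<open>J\<close> onto
      \<open>I\<close>.\<close>
    define I where "I = {i. i < t \<and> us ! i = v}"
    define J where "J = {i. i < t \<and> us ! (Suc i mod t) = v}"
    have "bij_betw (circuit_step us) (I \<union> J) {e \<in> E. v \<in> e}"
      unfolding bij_betw_def
    proof
      show "inj_on (circuit_step us) (I \<union> J)"
        using inE ex1 by (intro inj_onI) (auto simp: I_def J_def; metis)
      show "circuit_step us ` (I \<union> J) = {e \<in> E. v \<in> e}"
      proof
        show "circuit_step us ` (I \<union> J) \<subseteq> {e \<in> E. v \<in> e}"
          using inE by (auto simp: I_def J_def circuit_step_def t_def)
        show "{e \<in> E. v \<in> e} \<subseteq> circuit_step us ` (I \<union> J)"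
        proof
          fix e assume e: "e \<in> {e \<in> E. v \<in> e}"
          then obtain i where "i < t" "circuit_step us i = e" using ex1 by blast
          then show "e \<in> circuit_step us ` (I \<union> J)"
            using e by (force simp: I_def J_def circuit_step_def t_def)
        qed
      qed
    qed
    then have "deg E v = card (I \<union> J)" by (simp add: deg_def bij_betw_same_card)
    also have "\<dots> = card I + card J"
    proof (rule card_Un_disjoint)
      show "I \<inter> J = {}"
      proof (rule ccontr)
        assume "I \<inter> J \<noteq> {}"
        then obtain i where "i \<in> I" "i \<in> J" by blast
        then have "i < t" "us ! i = us ! (Suc i mod t)" by (simp_all add: I_def J_def)
        then have "circuit_step us i \<in> E" "circuit_step us i = {us ! i}"
          using inE[of i] unfolding circuit_step_def t_def by simp_all
        then show False using assms(1) by (auto simp: all_edges_def)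
      qed
    qed (auto simp: I_def J_def)
    also have "bij_betw (\<lambda>i. Suc i mod t) J I"
    \<comment> \<open>The witness is the backward shift; adding \<open>t\<close> before subtracting
      1 avoids truncation at position 0.\<close>
    proof (rule bij_betw_byWitness[where f' = "\<lambda>i. (i + t - 1) mod t"])
      have *: "Suc i mod t = (if Suc i = t then 0 else Suc i)" if "i < t" for i using that by auto
      have **: "(i + t - 1) mod t = (if i = 0 then t - 1 else i - 1)" if "i < t" for i
      proof (cases i)
        case (Suc j)
        then have "i + t - 1 = j + t" using that by simp
        then show ?thesis using Suc that by simp
      qed (use that in simp)
      show "\<forall>i\<in>J. (Suc i mod t + t - 1) mod t = i"
        unfolding J_def using * ** t by (auto simp del: mod_less)
      show inv: "\<forall>i\<in>I. Suc ((i + t - 1) mod t) mod t = i"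
        unfolding I_def using * ** t by (auto simp del: mod_less) simp
      show "(\<lambda>i. Suc i mod t) ` J \<subseteq> I" using t by (auto simp: I_def J_def)
      show "(\<lambda>i. (i + t - 1) mod t) ` I \<subseteq> J"
        using inv t by (auto simp: J_def simp del: mod_Suc_eq) (simp_all add: I_def)
    qed
    then have "card J = card I" by (rule bij_betw_same_card)
    finally show ?thesis by simp
  qed
  then show ?thesis by (simp add: odd_vertices_def)
qed

section \<open>Joins of the odd vertices and the three Eulerian numbers\<close>

lemma odd_card_sym_diff:
  assumes "finite A" "finite B"
  shows "odd (card (sym_diff A B)) \<longleftrightarrow> odd (card A) \<noteq> odd (card B)"
proof -
  have "card (sym_diff A B) = card (A - B) + card (B - A)"
    using assms by (intro card_Un_disjoint) auto
  moreover have "card A = card (A - B) + card (A \<inter> B)"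
    using assms by (subst card_Un_disjoint[symmetric]) (auto intro!: arg_cong[where f = card])
  moreover have "card B = card (B - A) + card (A \<inter> B)"
    using assms by (subst card_Un_disjoint[symmetric]) (auto intro!: arg_cong[where f = card])
  ultimately show ?thesis by auto
qed

lemma odd_deg_sym_diff:
  assumes "finite A" "finite B"
  shows "odd (deg (sym_diff A B) v) \<longleftrightarrow> odd (deg A v) \<noteq> odd (deg B v)"
proof -
  have "{e \<in> sym_diff A B. v \<in> e} = sym_diff {e \<in> A. v \<in> e} {e \<in> B. v \<in> e}" by auto
  then show ?thesis
    using odd_card_sym_diff[of "{e \<in> A. v \<in> e}" "{e \<in> B. v \<in> e}"] assms
    by (simp add: deg_def)
qed

text \<open>Taking odd vertices is linear over the field with two elements. Editing \<open>E\<close>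
  by a set with the same odd vertices therefore cancels them all.\<close>

lemma odd_vertices_sym_diff:
  assumes "finite A" "finite B"
  shows "odd_vertices V (sym_diff A B) = sym_diff (odd_vertices V A) (odd_vertices V B)"
  using odd_deg_sym_diff[OF assms] unfolding odd_vertices_def by blast

lemma odd_vertices_empty [simp]: "odd_vertices V {} = {}"
  by (simp add: odd_vertices_def deg_def)

lemma odd_vertices_singleton: "odd_vertices V {e} = V \<inter> e"
proof -
  have "{e'. e' = e \<and> v \<in> e'} = (if v \<in> e then {e} else {})" for v by auto
  then show ?thesis by (auto simp: odd_vertices_def deg_def)
qed

text \<open>The handshake lemma: each edge changes the set of odd vertices by symmetric difference
  with a two-element set.\<close>

lemma even_card_odd_vertices:
  assumes "finite V" "E \<subseteq> all_edges V"
  shows "even (card (odd_vertices V E))"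
proof -
  have "finite E" using assms finite_all_edges finite_subset by blast
  then show ?thesis using assms(2)
  proof (induction E rule: finite_induct)
    case (insert e E)
    have eq: "insert e E = sym_diff E {e}" using insert by auto
    have e: "e \<subseteq> V" "card e = 2" using insert by (auto simp: all_edges_def)
    have "finite (odd_vertices V E)" using assms(1) by (simp add: odd_vertices_def)
    moreover have "finite e" using e assms(1) finite_subset by blast
    moreover have "odd_vertices V (insert e E) = sym_diff (odd_vertices V E) e"
      unfolding eq using insert e by (subst odd_vertices_sym_diff) (auto simp: odd_vertices_singleton)
    moreover have "even (card (odd_vertices V E))" using insert by simp
    ultimately show ?case using e(2) odd_card_sym_diff[of "odd_vertices V E" e] by simp
  qed simp
qed

text \<open>The first clause makes greedy matchings nearly perfect, the second supplies paths of
  length two. Three common neighbours are required because deleting a matching can spoil two of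
  them, one through each end point. The notion is applied to the graph and to its complement
  alike.\<close>

definition well_spread :: "nat \<Rightarrow> 'a set \<Rightarrow> 'a set set \<Rightarrow> bool" where
  "well_spread s V G \<longleftrightarrow>
     (\<forall>S. S \<subseteq> V \<and> card S = s \<longrightarrow> (\<exists>e\<in>G. e \<subseteq> S)) \<and>
     (\<forall>u\<in>V. \<forall>v\<in>V. u \<noteq> v \<longrightarrow> 3 \<le> card {w \<in> V. {u, w} \<in> G \<and> {v, w} \<in> G})"

lemma well_spread_edge:
  assumes "well_spread s V G" "S \<subseteq> V" "card S = s"
  obtains e where "e \<in> G" "e \<subseteq> S"
  using assms by (auto simp: well_spread_def)

lemma well_spread_common_neighbour:
  assumes "well_spread s V G" "u \<in> V" "v \<in> V" "u \<noteq> v"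
  obtains w where "w \<in> V" "{u, w} \<in> G" "{v, w} \<in> G"
proof -
  have "card {w \<in> V. {u, w} \<in> G \<and> {v, w} \<in> G} \<ge> 3"
    using assms by (auto simp: well_spread_def)
  then have "{w \<in> V. {u, w} \<in> G \<and> {v, w} \<in> G} \<noteq> {}" by (metis card.empty not_numeral_le_zero)
  then show ?thesis using that by blast
qed

text \<open>Greedy choice: as long as \<open>s\<close> vertices remain they span an edge, which is
  taken and its end points discarded. The alternative \<open>U = {}\<close> covers
  \<open>s = 0\<close>, where \<open>card U < s\<close> is impossible.\<close>

lemma near_perfect_matching:
  assumes "finite V" "G \<subseteq> all_edges V" "well_spread s V G" "T \<subseteq> V"
  obtains M U where "M \<subseteq> G" "finite M" "\<Union>M \<subseteq> T" "\<forall>v. deg M v \<le> 1" "U \<subseteq> T" "card U < s \<or> U = {}"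
    "odd_vertices V M = T - U" "2 * card M + card U = card T"
proof -
  have "finite T" using assms(1,4) finite_subset by blast
  then have "\<exists>M U. M \<subseteq> G \<and> finite M \<and> \<Union>M \<subseteq> T \<and> (\<forall>v. deg M v \<le> 1) \<and> U \<subseteq> T \<and> (card U < s \<or> U = {}) \<and>
    odd_vertices V M = T - U \<and> 2 * card M + card U = card T"
    using assms(4)
  proof (induction T rule: finite_psubset_induct)
    case (psubset T)
    show ?case
    proof (cases "card T < s \<or> T = {}")
      case True
      then show ?thesis by (intro exI[of _ "{}"] exI[of _ T]) (auto simp: deg_def)
    next
      case False
      then obtain S where S: "S \<subseteq> T" "card S = s"
        using obtain_subset_with_card_n[of s T] by auto
      then have "S \<subseteq> V" using psubset(3) by blast
      then obtain e where e: "e \<in> G" "e \<subseteq> S"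
        using S(2) by (rule well_spread_edge[OF assms(3)])
      have e_T: "e \<subseteq> T" using e S by blast
      have e_V: "card e = 2" "e \<subseteq> V" using e assms(2) by (auto simp: all_edges_def)
      have e2: "card e = 2" "finite e" "e \<noteq> {}" "e \<subseteq> T" "e \<subseteq> V"
        using e_T e_V finite_subset[OF e_T psubset(1)] by auto
      obtain M U where M: "M \<subseteq> G" "finite M" "\<Union>M \<subseteq> T - e" "\<forall>v. deg M v \<le> 1" "U \<subseteq> T - e"
        "card U < s \<or> U = {}" "odd_vertices V M = T - e - U" "2 * card M + card U = card (T - e)"
      proof -
        have "T - e \<subset> T" "T - e \<subseteq> V" using e2 psubset(3) by auto
        from psubset(2)[OF this] show ?thesis using that by (elim exE conjE)
      qed
      have enM: "e \<notin> M" using M(3) e2 by auto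
      have "deg (insert e M) v \<le> 1" for v
      proof (cases "v \<in> e")
        case True
        then have "{e' \<in> insert e M. v \<in> e'} = {e}" using M(3) by auto
        then show ?thesis by (simp add: deg_def)
      next
        case False
        then have "{e' \<in> insert e M. v \<in> e'} = {e' \<in> M. v \<in> e'}" by auto
        then show ?thesis using M(4) by (simp add: deg_def)
      qed
      then have "\<forall>v. deg (insert e M) v \<le> 1" by blast
      moreover have "odd_vertices V (insert e M) = T - U"
      proof -
        have "insert e M = sym_diff M {e}" using enM by auto
        moreover have "V \<inter> e = e" using e2 by blast
        ultimately have "odd_vertices V (insert e M) = sym_diff (T - e - U) e"
          using odd_vertices_sym_diff[OF M(2), of "{e}" V] M(7) by (simp add: odd_vertices_singleton)
        then show ?thesis using M(5) e_T by blast
      qed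
      moreover have "2 * card (insert e M) + card U = card T"
        using M(2,8) enM e2 card_mono[OF psubset(1) e_T] by (simp add: card_Diff_subset)
      ultimately show ?thesis
        using M(1,2,3,5,6) e(1) e_T by (intro exI[of _ "insert e M"] exI[of _ U] conjI) auto
    qed
  qed
  then show ?thesis using that by blast
qed

text \<open>Pair up the vertices of \<open>U\<close> and join each pair through a common neighbour,
  at a cost of two edges for two vertices. Symmetric differences keep the parities right even when
  the paths share edges.\<close>

lemma join_by_two_paths:
  assumes "finite V" "G \<subseteq> all_edges V" "well_spread s V G" "U \<subseteq> V" "even (card U)"
  obtains P where "P \<subseteq> G" "finite P" "card P \<le> card U" "odd_vertices V P = U"
proof -
  have "finite U" using assms(1,4) finite_subset by blast
  then have "\<exists>P. P \<subseteq> G \<and> finite P \<and> card P \<le> card U \<and> odd_vertices V P = U"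
    using assms(4,5)
  proof (induction U rule: finite_psubset_induct)
    case (psubset U)
    show ?case
    proof (cases "U = {}")
      case False
      then have "card U \<ge> 2" using psubset(1,4)
        by (metis card_0_eq dvd_imp_le gr0I)
      then obtain S where S: "S \<subseteq> U" "card S = 2" by (rule obtain_subset_with_card_n)
      then obtain u v where uv: "S = {u,v}" "u \<noteq> v" by (auto simp: card_2_iff)
      then have V: "u \<in> V" "v \<in> V" using S psubset by auto
      then obtain w where w: "w \<in> V" "{u,w} \<in> G" "{v,w} \<in> G"
        using well_spread_common_neighbour[OF assms(3)] uv by blast
      then have ne: "u \<noteq> w" "v \<noteq> w" using assms(2) by (auto simp: all_edges_def)
      have cU: "card U = card (U - S) + 2"
        using S psubset(1) card_mono[of U S]
        by (simp add: card_Diff_subset finite_subset)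
      then obtain P where P: "P \<subseteq> G" "finite P" "card P \<le> card (U - S)" "odd_vertices V P = U - S"
      proof -
        have "U - S \<subset> U" "U - S \<subseteq> V" "even (card (U - S))"
          using psubset(3,4) S(1) uv cU by auto
        from psubset(2)[OF this] show ?thesis using that by (elim exE conjE)
      qed
      let ?Q = "{{u,w},{v,w}}"
      \<comment> \<open>In this form the middle vertex \<open>w\<close>, which lies on both edges,
        cancels and only \<open>u\<close> and \<open>v\<close> stay odd.\<close>
      have "?Q = sym_diff {{u,w}} {{v,w}}" using uv ne by (auto simp: doubleton_eq_iff)
      then have Q: "odd_vertices V ?Q = S"
        using uv ne V w(1) by (simp only: odd_vertices_sym_diff odd_vertices_singleton finite.intros) auto
      have "odd_vertices V (sym_diff P ?Q) = U"
        using odd_vertices_sym_diff[OF P(2), of ?Q V] Q P(4) S(1) by auto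
      moreover have "card (sym_diff P ?Q) \<le> card U"
      proof -
        have "card (sym_diff P ?Q) \<le> card (P \<union> ?Q)" using P by (intro card_mono) auto
        also have "\<dots> \<le> card P + card ?Q" by (rule card_Un_le)
        also have "card ?Q \<le> 2" by (simp add: card_insert_if)
        finally show ?thesis using P(3) cU by simp
      qed
      ultimately show ?thesis using P w by (intro exI[of _ "sym_diff P ?Q"]) auto
    qed (auto intro: exI[of _ "{}"])
  qed
  then show ?thesis using that by blast
qed

text \<open>The matching \<open>M\<close> repairs \<open>T - U\<close> and the paths
  \<open>P\<close> repair the leftover \<open>U\<close>. Both parts are kept visible because they
  hurt connectivity differently when deleted: \<open>M\<close> takes at most one edge at each
  vertex, \<open>P\<close> is small in total.\<close>

lemma small_join:
  assumes "finite V" "G \<subseteq> all_edges V" "well_spread s V G" "T \<subseteq> V" "even (card T)"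
  obtains M P where "M \<subseteq> G" "P \<subseteq> G" "finite M" "finite P" "\<forall>v. deg M v \<le> 1" "card P \<le> s"
    "odd_vertices V (sym_diff M P) = T" "2 * card (sym_diff M P) \<le> card T + 2 * s"
proof -
  obtain M U where M: "M \<subseteq> G" "finite M" "\<Union>M \<subseteq> T" "\<forall>v. deg M v \<le> 1" "U \<subseteq> T" "card U < s \<or> U = {}"
    "odd_vertices V M = T - U" "2 * card M + card U = card T"
    by (rule near_perfect_matching[OF assms(1-4)])
  have "even (card U)" using M(8) assms(5) by (metis dvd_add_right_iff dvd_triv_left)
  then obtain P where P: "P \<subseteq> G" "finite P" "card P \<le> card U" "odd_vertices V P = U"
    by (rule join_by_two_paths[OF assms(1-3) subset_trans[OF M(5) assms(4)]])
  have U: "card U \<le> s" using M(6) by auto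
  have "card (sym_diff M P) \<le> card (M \<union> P)" using P M by (intro card_mono) auto
  also have "\<dots> \<le> card M + card P" by (rule card_Un_le)
  finally have "2 * card (sym_diff M P) \<le> card T + 2 * s" using M(8) P(3) U by linarith
  moreover have "odd_vertices V (sym_diff M P) = T"
    using odd_vertices_sym_diff[OF M(2) P(2), of V] M(5,7) P(4) by auto
  ultimately show ?thesis using that[of M P] M(1,2,4) P(1-3) U by simp
qed

section \<open>Connectivity before and after deleting a join\<close>

lemma connected_well_spread:
  assumes "well_spread s V G"
  shows "connected_graph V G"
  unfolding connected_graph_def
proof (intro ballI)
  fix u v assume uv: "u \<in> V" "v \<in> V"
  show "(u, v) \<in> {(x, y). {x, y} \<in> G}\<^sup>*"
  proof (cases "u = v")
    case False
    then obtain w where "{u, w} \<in> G" "{v, w} \<in> G"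
      using well_spread_common_neighbour[OF assms uv] by blast
    then have "(u, w) \<in> {(x, y). {x, y} \<in> G}" "(w, v) \<in> {(x, y). {x, y} \<in> G}"
      by (auto simp: insert_commute)
    then show ?thesis by (meson r_into_rtrancl rtrancl_trans)
  qed simp
qed

lemma connected_graph_mono: "connected_graph V E \<Longrightarrow> E \<subseteq> E' \<Longrightarrow> connected_graph V E'"
  using rtrancl_mono[of "{(x, y). {x, y} \<in> E}" "{(x, y). {x, y} \<in> E'}"]
  unfolding connected_graph_def by blast

lemma card_le_deg:
  assumes "finite M" "\<And>w. w \<in> W \<Longrightarrow> {a, w} \<in> M"
  shows "card W \<le> deg M a"
  unfolding deg_def
  by (rule card_inj_on_le[where f = "\<lambda>w. {a, w}"])
    (use assms in \<open>auto simp: inj_on_def doubleton_eq_iff\<close>)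

text \<open>A vertex loses at most one edge to the matching and at most all \<open>s\<close> edges
  of the paths.\<close>

lemma deg_Diff:
  assumes "finite E" "F \<subseteq> M \<union> P" "finite M" "finite P" "deg M u \<le> 1" "card P \<le> s"
  shows "deg E u \<le> deg (E - F) u + 1 + s"
proof -
  have "deg E u \<le> card ({e \<in> E - F. u \<in> e} \<union> {e \<in> M. u \<in> e} \<union> P)"
    unfolding deg_def using assms by (intro card_mono) auto
  also have "\<dots> \<le> deg (E - F) u + deg M u + card P"
    unfolding deg_def by (intro order.trans[OF card_Un_le] add_right_mono card_Un_le)
  finally show ?thesis using assms by linarith
qed

text \<open>
  A vertex untouched by \<open>P\<close> loses at most one edge, so two such vertices keep one of their three
  common neighbours; and every vertex keeps an edge to an untouched vertex.
\<close>

lemma connected_Diff: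
  assumes "finite V" "E \<subseteq> all_edges V" "well_spread s V E" "\<And>v. v \<in> V \<Longrightarrow> 3 * s + 5 \<le> deg E v"
    and "finite M" "P \<subseteq> E" "finite P" "\<forall>v. deg M v \<le> 1" "card P \<le> s" "F \<subseteq> M \<union> P"
  shows "connected_graph V (E - F)"
proof -
  let ?R = "{(x, y). {x, y} \<in> E - F}\<^sup>*"
  have finE: "finite E" using assms(1,2) finite_all_edges finite_subset by blast
  have sym: "sym ?R" by (intro sym_rtrancl symI) (auto simp: insert_commute)
  have cP: "card (\<Union>P) \<le> 2 * s"
  proof -
    have "card (\<Union>P) \<le> sum card P"
      by (rule card_Union_le_sum_card)
    also have "\<dots> = (\<Sum>e\<in>P. 2)" using assms(2,6) by (intro sum.cong) (auto simp: all_edges_def)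
    finally show ?thesis using assms(9) by simp
  qed
  have "\<Union>P \<subseteq> V" using assms(2,6) unfolding all_edges_def by blast
  then have finUP: "finite (\<Union>P)" using assms(1) finite_subset by blast
  \<comment> \<open>This fixes the constant \<open>3 * s + 5\<close>: after losing at most
    \<open>s + 1\<close> edges, \<open>u\<close> keeps more than \<open>2 * s\<close>, while
    \<open>P\<close> touches at most \<open>2 * s\<close> vertices.\<close>
  have clean: "\<exists>a\<in>V - \<Union>P. (u, a) \<in> ?R" if u: "u \<in> V" for u
  proof -
    have "card ((\<lambda>w. {u, w}) ` \<Union>P) \<le> 2 * s"
      using card_image_le[OF finUP] cP by (rule order.trans)
    moreover have "2 * s < card {e \<in> E - F. u \<in> e}"
      using deg_Diff[OF finE assms(10,5,7) spec[OF assms(8), of u] assms(9)] assms(4)[OF u]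
      by (simp add: deg_def)
    ultimately have "\<not> {e \<in> E - F. u \<in> e} \<subseteq> (\<lambda>w. {u, w}) ` \<Union>P"
      using card_mono[OF finite_imageI[OF finUP], of "{e \<in> E - F. u \<in> e}" "\<lambda>w. {u, w}"] by linarith
    then obtain e where e: "e \<in> E - F" "u \<in> e" "e \<notin> (\<lambda>w. {u, w}) ` \<Union>P" by blast
    have "card e = 2" using e(1) assms(2) by (auto simp: all_edges_def)
    then obtain a where a: "e = {u, a}" using e(2) by (auto simp: card_2_iff insert_commute)
    then have "a \<in> V - \<Union>P" using e assms(2) by (auto simp: all_edges_def)
    then show ?thesis using a e by blast
  qed
  have link: "(a, b) \<in> ?R" if ab: "a \<in> V - \<Union>P" "b \<in> V - \<Union>P" for a b
  proof (cases "a = b")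
    case False
    let ?W = "{w \<in> V. {a, w} \<in> E \<and> {b, w} \<in> E}"
    have W3: "3 \<le> card ?W" using assms(3) ab False by (auto simp: well_spread_def)
    have fin: "finite ({w \<in> V. {a, w} \<in> M} \<union> {w \<in> V. {b, w} \<in> M})"
      using assms(1) by simp
    have le1: "card {w \<in> V. {x, w} \<in> M} \<le> 1" for x
      using card_le_deg[OF assms(5), of "{w \<in> V. {x, w} \<in> M}" x] spec[OF assms(8), of x] by auto
    have "card ({w \<in> V. {a, w} \<in> M} \<union> {w \<in> V. {b, w} \<in> M}) \<le> 2"
      using card_Un_le[of "{w \<in> V. {a, w} \<in> M}" "{w \<in> V. {b, w} \<in> M}"] le1[of a] le1[of b]
      by linarith
    then have "\<not> ?W \<subseteq> {w \<in> V. {a, w} \<in> M} \<union> {w \<in> V. {b, w} \<in> M}"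
      using card_mono[OF fin, of ?W] W3 by linarith
    then obtain w where w: "w \<in> V" "{a, w} \<in> E" "{b, w} \<in> E" "{a, w} \<notin> M" "{b, w} \<notin> M" by blast
    then have "{a, w} \<in> E - F" "{w, b} \<in> E - F" using assms(10) ab by (auto simp: insert_commute)
    then show ?thesis by (auto intro: converse_rtrancl_into_rtrancl r_into_rtrancl)
  qed simp
  show ?thesis unfolding connected_graph_def
  proof (intro ballI)
    fix u v assume uv: "u \<in> V" "v \<in> V"
    obtain a where a: "a \<in> V - \<Union>P" "(u, a) \<in> ?R" using clean[OF uv(1)] by blast
    obtain b where b: "b \<in> V - \<Union>P" "(v, b) \<in> ?R" using clean[OF uv(2)] by blast
    show "(u, v) \<in> ?R"
      by (rule rtrancl_trans[OF a(2) rtrancl_trans[OF link[OF a(1) b(1)] symD[OF sym b(2)]]])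
  qed
qed

section \<open>The three numbers compared with each other and with the number of odd
  vertices\<close>

lemma edit_graph_odd_vertices:
  assumes "finite V" "E \<subseteq> all_edges V" "edit_graph V k E E'"
  shows "E' \<subseteq> all_edges V \<and> card (odd_vertices V E) \<le> card (odd_vertices V E') + 2 * k"
  using assms(3)
proof (induction k arbitrary: E')
  case (Suc k)
  then obtain D where D: "edit_graph V k E D" "one_edit V D E'" by auto
  have IH: "D \<subseteq> all_edges V" "card (odd_vertices V E) \<le> card (odd_vertices V D) + 2 * k"
    using Suc.IH[OF D(1)] by auto
  \<comment> \<open>Adding and removing an edge are both symmetric difference with
    \<open>{e}\<close>, so one argument serves both kinds of edit.\<close>
  obtain e where e: "e \<in> all_edges V" "E' = sym_diff D {e}"
    using D(2) IH(1) unfolding one_edit_def by blast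
  have fin: "finite D" using IH(1) assms(1) finite_all_edges finite_subset by blast
  have e2: "card e = 2" "e \<subseteq> V" "finite e" using e(1) assms(1) by (auto simp: all_edges_def intro: finite_subset)
  have "odd_vertices V D \<subseteq> odd_vertices V E' \<union> e"
    unfolding e(2) using odd_vertices_sym_diff[OF fin, of "{e}" V] by (auto simp: odd_vertices_singleton)
  then have "card (odd_vertices V D) \<le> card (odd_vertices V E' \<union> e)"
    using assms(1) e2 by (intro card_mono) (auto simp: odd_vertices_def)
  also have "\<dots> \<le> card (odd_vertices V E') + card e" by (rule card_Un_le)
  finally show ?case using IH e e2 by auto
qed (use assms in auto)

lemma edit_graph_add: "finite F \<Longrightarrow> F \<subseteq> all_edges V - E \<Longrightarrow> edit_graph V (card F) E (E \<union> F)"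
proof (induction F rule: finite_induct)
  case (insert e F)
  then show ?case by (auto simp: one_edit_def intro!: exI[of _ "E \<union> F"])
qed simp

lemma edit_graph_remove: "finite F \<Longrightarrow> F \<subseteq> E \<Longrightarrow> edit_graph V (card F) E (E - F)"
proof (induction F rule: finite_induct)
  case (insert e F)
  have "E - insert e F = E - F - {e}" "e \<in> E - F" using insert by auto
  then have "one_edit V (E - F) (E - insert e F)" unfolding one_edit_def by blast
  moreover have "edit_graph V (card F) E (E - F)" using insert by simp
  ultimately show ?case using insert(1,2) by auto
qed simp

text \<open>A given Eulerian \<open>k\<close>-edit graph ensures that the minimum is attained. The
  minimiser has no odd vertices, and each edit removes at most two of them.\<close>

lemma N_edit_ge:
  assumes "finite V" "E \<subseteq> all_edges V" "edit_graph V k E E'" "eulerian V E'"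
  shows "card (odd_vertices V E) \<le> 2 * N_edit V E" "N_edit V E \<le> k"
proof -
  have ex: "\<exists>E'. edit_graph V k E E' \<and> eulerian V E'" using assms by blast
  then obtain D where D: "edit_graph V (N_edit V E) E D" "eulerian V D"
    unfolding N_edit_def using LeastI_ex[of "\<lambda>k. \<exists>E'. edit_graph V k E E' \<and> eulerian V E'"] by blast
  show "card (odd_vertices V E) \<le> 2 * N_edit V E"
    using edit_graph_odd_vertices[OF assms(1,2) D(1)] odd_vertices_eulerian[OF _ D(2)] by auto
  show "N_edit V E \<le> k" unfolding N_edit_def by (rule Least_le) (rule ex)
qed

text \<open>Adding a set of edges one at a time is a sequence of edits, so every lower bound for
  \<open>N_edit\<close> passes to \<open>N_ext\<close>.\<close>

lemma N_ext_bounds: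
  assumes "finite V" "E \<subseteq> all_edges V" "extends_to_eulerian V E F"
  shows "N_edit V E \<le> N_ext V E" "N_ext V E \<le> card F"
proof -
  have ex: "\<exists>F'. extends_to_eulerian V E F' \<and> card F' = card F" using assms by blast
  then obtain D where "extends_to_eulerian V E D" "card D = N_ext V E"
    unfolding N_ext_def using LeastI_ex[of "\<lambda>k. \<exists>F. extends_to_eulerian V E F \<and> card F = k"] by blast
  then show "N_edit V E \<le> N_ext V E"
    using N_edit_ge(2)[OF assms(1,2)] edit_graph_add[of D V E] by (auto simp: extends_to_eulerian_def)
  show "N_ext V E \<le> card F" unfolding N_ext_def by (rule Least_le) (rule ex)
qed

lemma N_red_bounds:
  assumes "finite V" "E \<subseteq> all_edges V" "reduces_to_eulerian V E F"
  shows "N_edit V E \<le> N_red V E" "N_red V E \<le> card F"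
proof -
  have ex: "\<exists>F'. reduces_to_eulerian V E F' \<and> card F' = card F" using assms by blast
  then obtain D where "reduces_to_eulerian V E D" "card D = N_red V E"
    unfolding N_red_def using LeastI_ex[of "\<lambda>k. \<exists>F. reduces_to_eulerian V E F \<and> card F = k"] by blast
  then show "N_edit V E \<le> N_red V E"
    using N_edit_ge(2)[OF assms(1,2)] edit_graph_remove[of D E V] by (auto simp: reduces_to_eulerian_def)
  show "N_red V E \<le> card F" unfolding N_red_def by (rule Least_le) (rule ex)
qed

text \<open>The join is chosen in the complement, where adding it is the same as taking the
  symmetric difference. Connectedness is inherited from \<open>E\<close>.\<close>

lemma small_extension:
  assumes "finite V" "E \<subseteq> all_edges V" "well_spread s V E" "well_spread s V (all_edges V - E)" "3 \<le> card E"
  obtains F where "extends_to_eulerian V E F" "2 * card F \<le> card (odd_vertices V E) + 2 * s"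
proof -
  have T: "odd_vertices V E \<subseteq> V" by (auto simp: odd_vertices_def)
  obtain M P where M: "M \<subseteq> all_edges V - E" "P \<subseteq> all_edges V - E" "finite M" "finite P"
    "\<forall>v. deg M v \<le> 1" "card P \<le> s"
    "odd_vertices V (sym_diff M P) = odd_vertices V E" "2 * card (sym_diff M P) \<le> card (odd_vertices V E) + 2 * s"
    by (rule small_join[OF assms(1) Diff_subset assms(4) T even_card_odd_vertices[OF assms(1,2)]])
  let ?F = "sym_diff M P"
  have finE: "finite E" using assms(1,2) finite_all_edges finite_subset by blast
  have eq: "E \<union> ?F = sym_diff E ?F" using M by auto
  have "eulerian V (E \<union> ?F)"
  proof (rule eulerian_if_even)
    show "connected_graph V (E \<union> ?F)"
      using connected_graph_mono[OF connected_well_spread[OF assms(3)]] by blast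
    show "3 \<le> card (E \<union> ?F)"
      using assms(5) card_mono[of "E \<union> ?F" E] finE M by auto
    show "odd_vertices V (E \<union> ?F) = {}"
      unfolding eq using odd_vertices_sym_diff[OF finE, of ?F V] M by auto
  qed (use finE M assms in auto)
  then have "extends_to_eulerian V E ?F" using M by (auto simp: extends_to_eulerian_def)
  then show ?thesis using that M by blast
qed

text \<open>The join is chosen inside \<open>E\<close>, so deleting it is again a symmetric
  difference. Here connectedness has to survive the deletion, which is where the minimum degree
  enters.\<close>

lemma small_reduction:
  assumes "finite V" "V \<noteq> {}" "E \<subseteq> all_edges V" "well_spread s V E"
    "\<And>v. v \<in> V \<Longrightarrow> 3 * s + 5 \<le> deg E v"
  obtains F where "reduces_to_eulerian V E F" "2 * card F \<le> card (odd_vertices V E) + 2 * s"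
proof -
  have T: "odd_vertices V E \<subseteq> V" by (auto simp: odd_vertices_def)
  obtain M P where M: "M \<subseteq> E" "P \<subseteq> E" "finite M" "finite P" "\<forall>v. deg M v \<le> 1" "card P \<le> s"
    "odd_vertices V (sym_diff M P) = odd_vertices V E" "2 * card (sym_diff M P) \<le> card (odd_vertices V E) + 2 * s"
    by (rule small_join[OF assms(1,3,4) T even_card_odd_vertices[OF assms(1,3)]])
  let ?F = "sym_diff M P"
  have finE: "finite E" using assms(1,3) finite_all_edges finite_subset by blast
  have eq: "E - ?F = sym_diff E ?F" using M by auto
  have FMP: "?F \<subseteq> M \<union> P" by auto
  obtain u where u: "u \<in> V" using assms(2) by blast
  have c3: "3 \<le> card (E - ?F)"
  proof -
    have "3 \<le> deg (E - ?F) u"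
      using deg_Diff[OF finE FMP M(3,4) spec[OF M(5), of u] M(6)] assms(5)[OF u] by simp
    also have "\<dots> \<le> card (E - ?F)" unfolding deg_def using finE by (intro card_mono) auto
    finally show ?thesis .
  qed
  have "eulerian V (E - ?F)"
  proof (rule eulerian_if_even)
    show "connected_graph V (E - ?F)"
      by (rule connected_Diff[OF assms(1,3,4,5) M(3,2,4,5,6) FMP])
    show "odd_vertices V (E - ?F) = {}"
      by (subst eq) (use odd_vertices_sym_diff[OF finE, of ?F V] M in auto)
  qed (use finE assms c3 in auto)
  moreover have "E - ?F \<noteq> {}" using c3 by (metis card.empty not_numeral_le_zero)
  ultimately have "reduces_to_eulerian V E ?F" using M by (auto simp: reduces_to_eulerian_def)
  then show ?thesis using that M by blast
qed

text \<open>\<open>N_edit\<close> is at most the other two numbers, so the lower bound is proved for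
  it alone; the upper bounds come from the small extension and the small reduction.\<close>

theorem eulerian_numbers_bounds:
  assumes "finite V" "V \<noteq> {}" "E \<subseteq> all_edges V" "well_spread s V E" "well_spread s V (all_edges V - E)"
    "\<And>v. v \<in> V \<Longrightarrow> 3 * s + 5 \<le> deg E v"
  shows "eulerian_extendable V E" "eulerian_reducable V E"
    and "\<forall>k \<in> {N_edit V E, N_ext V E, N_red V E}.
      card (odd_vertices V E) \<le> 2 * k \<and> 2 * k \<le> card (odd_vertices V E) + 2 * s"
proof -
  obtain u where u: "u \<in> V" using assms(2) by blast
  have finE: "finite E" using assms(1,3) finite_all_edges finite_subset by blast
  have "deg E u \<le> card E" unfolding deg_def using finE by (intro card_mono) auto
  then have "3 \<le> card E" using assms(6)[OF u] by linarith
  then obtain F where F: "extends_to_eulerian V E F" "2 * card F \<le> card (odd_vertices V E) + 2 * s"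
    using small_extension[OF assms(1,3,4,5)] by blast
  obtain F' where F': "reduces_to_eulerian V E F'" "2 * card F' \<le> card (odd_vertices V E) + 2 * s"
    using small_reduction[OF assms(1,2,3,4,6)] by blast
  show "eulerian_extendable V E" "eulerian_reducable V E"
    using F F' by (auto simp: eulerian_extendable_def eulerian_reducable_def)
  have low: "card (odd_vertices V E) \<le> 2 * N_edit V E"
    using N_edit_ge(1)[OF assms(1,3) edit_graph_add] F(1) by (auto simp: extends_to_eulerian_def)
  show "\<forall>k \<in> {N_edit V E, N_ext V E, N_red V E}.
      card (odd_vertices V E) \<le> 2 * k \<and> 2 * k \<le> card (odd_vertices V E) + 2 * s"
    using low F(2) F'(2) N_ext_bounds[OF assms(1,3) F(1)] N_red_bounds[OF assms(1,3) F'(1)]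
    by auto
qed

section \<open>Products of independent edge variables\<close>

lemma expectation_prod_Pi_pmf_subset:
  fixes f :: "'a \<Rightarrow> 'b \<Rightarrow> real"
  assumes "finite A" "B \<subseteq> A" "\<And>e. e \<in> B \<Longrightarrow> integrable (measure_pmf (p e)) (f e)"
  shows "measure_pmf.expectation (Pi_pmf A d p) (\<lambda>X. \<Prod>e\<in>B. f e (X e)) =
    (\<Prod>e\<in>B. measure_pmf.expectation (p e) (f e))"
proof -
  let ?\<Omega> = "measure_pmf (Pi_pmf A d p)"
  have component: "p e = map_pmf (\<lambda>X. X e) (Pi_pmf A d p)" if "e \<in> B" for e
    using that assms(1,2) by (subst Pi_pmf_component) auto
  have "prob_space.indep_vars ?\<Omega> (\<lambda>_. count_space UNIV) (\<lambda>e X. X e) B"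
    by (rule prob_space.indep_vars_subset[OF measure_pmf.prob_space_axioms indep_vars_Pi_pmf[OF assms(1)] assms(2)])
  then have "prob_space.indep_vars ?\<Omega> (\<lambda>_. borel) (\<lambda>e X. f e (X e)) B"
    by (rule prob_space.indep_vars_compose2[OF measure_pmf.prob_space_axioms]) auto
  moreover have "integrable ?\<Omega> (\<lambda>X. f e (X e))" if "e \<in> B" for e
    using assms(3)[OF that] by (subst (asm) component[OF that]) (simp add: integrable_map_pmf_eq)
  moreover have "finite B" using assms(1,2) finite_subset by blast
  ultimately have "(\<integral>X. (\<Prod>e\<in>B. f e (X e)) \<partial>?\<Omega>) = (\<Prod>e\<in>B. \<integral>X. f e (X e) \<partial>?\<Omega>)"
    by (intro prob_space.indep_vars_lebesgue_integral[OF measure_pmf.prob_space_axioms]) auto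
  also have "\<dots> = (\<Prod>e\<in>B. measure_pmf.expectation (p e) (f e))"
  proof (rule prod.cong[OF refl])
    fix e assume "e \<in> B"
    show "(\<integral>X. f e (X e) \<partial>?\<Omega>) = measure_pmf.expectation (p e) (f e)"
      by (subst component[OF \<open>e \<in> B\<close>]) simp
  qed
  finally show ?thesis .
qed

text \<open>The law behind \<open>gnp\<close> before passing to edge sets; independence is used at
  the level of these edge indicators.\<close>

definition edge_vars :: "'a set \<Rightarrow> real \<Rightarrow> ('a \<Rightarrow> bool) pmf" where
  "edge_vars A p = Pi_pmf A False (\<lambda>_. bernoulli_pmf p)"

lemma finite_set_edge_vars: "finite A \<Longrightarrow> finite (set_pmf (edge_vars A p))"
  unfolding edge_vars_def
  by (rule finite_subset[OF set_Pi_pmf_subset']) (auto intro!: finite_PiE_dflt intro: finite_subset[OF subset_UNIV])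

lemma integrable_edge_vars [intro]:
  fixes f :: "('a \<Rightarrow> bool) \<Rightarrow> real"
  shows "finite A \<Longrightarrow> integrable (measure_pmf (edge_vars A p)) f"
  by (rule integrable_measure_pmf_finite[OF finite_set_edge_vars])

lemma expectation_prod_edge_vars:
  fixes h :: "bool \<Rightarrow> real"
  assumes "finite A" "B \<subseteq> A"
  shows "measure_pmf.expectation (edge_vars A p) (\<lambda>X. \<Prod>e\<in>B. h (X e)) =
    measure_pmf.expectation (bernoulli_pmf p) h ^ card B"
proof -
  have "integrable (measure_pmf (bernoulli_pmf p)) h"
    by (intro integrable_measure_pmf_finite) (auto intro: finite_subset[OF subset_UNIV])
  then show ?thesis
    unfolding edge_vars_def by (subst expectation_prod_Pi_pmf_subset[OF assms]) auto
qed

text \<open>Expand over subsets of \<open>I\<close>, factor each term over the disjoint blocks, and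
  recombine. With \<open>c = - 1 / 2\<close> and \<open>h\<close> an indicator, a factor is
  \<open>1 / 2\<close> on blocks that are entirely present and 1 on the others.\<close>

lemma expectation_prod_blocks:
  fixes h :: "bool \<Rightarrow> real"
  assumes "finite A" "finite I" "\<And>i. i \<in> I \<Longrightarrow> C i \<subseteq> A" "disjoint_family_on C I"
  shows "measure_pmf.expectation (edge_vars A p) (\<lambda>X. \<Prod>i\<in>I. c * (\<Prod>e\<in>C i. h (X e)) + 1) =
    (\<Prod>i\<in>I. c * measure_pmf.expectation (bernoulli_pmf p) h ^ card (C i) + 1)"
proof -
  let ?E = "measure_pmf.expectation (edge_vars A p)"
  let ?\<mu> = "measure_pmf.expectation (bernoulli_pmf p) h"
  have part: "?E (\<lambda>X. \<Prod>i\<in>J. c * (\<Prod>e\<in>C i. h (X e))) = (\<Prod>i\<in>J. c * ?\<mu> ^ card (C i))"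
    if J: "J \<subseteq> I" for J
  proof -
    have finJ: "finite J" "\<forall>i\<in>J. finite (C i)" 
      using J assms(1-3) by (meson finite_subset subsetD)+
    have disj: "\<forall>i\<in>J. \<forall>j\<in>J. i \<noteq> j \<longrightarrow> C i \<inter> C j = {}"
      using assms(4) J unfolding disjoint_family_on_def by blast
    have "(\<Prod>i\<in>J. c * (\<Prod>e\<in>C i. h (X e))) = c ^ card J * (\<Prod>e\<in>(\<Union>i\<in>J. C i). h (X e))" for X
      using prod.UNION_disjoint[OF finJ disj, of "\<lambda>e. h (X e)"] by (simp add: prod.distrib)
    then have "?E (\<lambda>X. \<Prod>i\<in>J. c * (\<Prod>e\<in>C i. h (X e))) = c ^ card J * ?\<mu> ^ card (\<Union>i\<in>J. C i)"
      using expectation_prod_edge_vars[OF assms(1), of "\<Union>i\<in>J. C i" p h] J assms(3) by auto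
    also have "card (\<Union>i\<in>J. C i) = (\<Sum>i\<in>J. card (C i))"
      by (rule card_UN_disjoint[OF finJ disj])
    finally show ?thesis by (simp add: prod.distrib power_sum)
  qed
  have "?E (\<lambda>X. \<Prod>i\<in>I. c * (\<Prod>e\<in>C i. h (X e)) + 1) =
      ?E (\<lambda>X. \<Sum>J\<in>Pow I. \<Prod>i\<in>J. c * (\<Prod>e\<in>C i. h (X e)))"
    using prod_add[OF assms(2), of _ "\<lambda>_. 1::real"] by simp
  also have "\<dots> = (\<Sum>J\<in>Pow I. \<Prod>i\<in>J. c * ?\<mu> ^ card (C i))"
    using part by (subst Bochner_Integration.integral_sum) (auto intro: integrable_edge_vars[OF assms(1)])
  also have "\<dots> = (\<Prod>i\<in>I. c * ?\<mu> ^ card (C i) + 1)"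
    using prod_add[OF assms(2), of _ "\<lambda>_. 1::real"] by simp
  finally show ?thesis .
qed

text \<open>Markov's inequality for \<open>2 powr (- count)\<close>.\<close>

lemma prob_few_blocks:
  fixes p q :: real
  assumes "finite A" "finite I" "\<And>i. i \<in> I \<Longrightarrow> C i \<subseteq> A" "disjoint_family_on C I"
    and "\<And>i. i \<in> I \<Longrightarrow> card (C i) = k"
    and p: "0 \<le> q" "q \<le> p" "p \<le> 1 - q"
  shows "measure_pmf.prob (edge_vars A p) {X. card {i \<in> I. \<forall>e\<in>C i. X e = b} \<le> m} \<le>
    2 ^ m * exp (- (card I * q ^ k / 2))"
proof -
  let ?E = "measure_pmf.expectation (edge_vars A p)"
  let ?N = "\<lambda>X. card {i \<in> I. \<forall>e\<in>C i. X e = b}"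
  let ?h = "\<lambda>x. of_bool (x = b) :: real"
  let ?\<mu> = "measure_pmf.expectation (bernoulli_pmf p) ?h"
  \<comment> \<open>The mean is \<open>p\<close> or \<open>1 - p\<close> according to
    \<open>b\<close>; the symmetric bounds on \<open>p\<close> let edges and non-edges be treated
    together.\<close>
  have \<mu>: "q \<le> ?\<mu>" "?\<mu> \<le> 1" using p by (cases b; simp)+
  have weight: "(1 / 2 :: real) ^ ?N X = (\<Prod>i\<in>I. (- 1 / 2) * (\<Prod>e\<in>C i. ?h (X e)) + 1)" for X
  proof -
    have "(\<Prod>i\<in>I. (- 1 / 2) * (\<Prod>e\<in>C i. ?h (X e)) + 1) =
        (\<Prod>i\<in>I. if \<forall>e\<in>C i. X e = b then 1 / 2 else 1 :: real)"
    proof (rule prod.cong[OF refl])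
      fix i assume "i \<in> I"
      then have "finite (C i)" using assms(1,3) finite_subset by blast
      then have "(\<Prod>e\<in>C i. ?h (X e)) = of_bool (\<forall>e\<in>C i. X e = b)"
        by (induction rule: finite_induct) simp_all
      then show "(- 1 / 2) * (\<Prod>e\<in>C i. ?h (X e)) + 1 =
          (if \<forall>e\<in>C i. X e = b then 1 / 2 else 1 :: real)" by simp
    qed
    also have "\<dots> = (1 / 2) ^ ?N X"
      using assms(2) by (simp add: prod.If_cases Int_def)
    finally show ?thesis by simp
  qed
  have "measure_pmf.prob (edge_vars A p) {X. ?N X \<le> m} = ?E (indicator {X. ?N X \<le> m})"
    by simp
  also have "\<dots> \<le> ?E (\<lambda>X. 2 ^ m * (1 / 2) ^ ?N X)"
  proof (intro integral_mono integrable_edge_vars assms(1))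
    fix X
    \<comment> \<open>On the event the weight is at least 1, which is the comparison behind Markov's
      inequality.\<close>
    have "(1 :: real) \<le> 2 ^ m * (1 / 2) ^ ?N X" if "?N X \<le> m"
    proof -
      have "(1 / 2 :: real) ^ m \<le> (1 / 2) ^ ?N X" by (rule power_decreasing[OF that]) auto
      then have "2 ^ m * (1 / 2 :: real) ^ m \<le> 2 ^ m * (1 / 2) ^ ?N X" by simp
      then show ?thesis by (simp add: power_mult_distrib[symmetric])
    qed
    then show "indicator {X. ?N X \<le> m} X \<le> (2 ^ m * (1 / 2) ^ ?N X :: real)"
      by (auto simp: indicator_def)
  qed
  also have "\<dots> = 2 ^ m * (\<Prod>i\<in>I. (- 1 / 2) * ?\<mu> ^ card (C i) + 1)"
    unfolding weight
    using expectation_prod_blocks[OF assms(1-4), of p "- 1 / 2" ?h]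
    by (simp only: integral_mult_right_zero)
  also have "(\<Prod>i\<in>I. (- 1 / 2) * ?\<mu> ^ card (C i) + 1) \<le> (\<Prod>i\<in>I. exp (- (q ^ k / 2)))"
  proof (rule prod_mono, intro conjI)
    fix i assume i: "i \<in> I"
    have "?\<mu> ^ card (C i) \<le> 1" using \<mu> p(1) by (intro power_le_one) auto
    then show "0 \<le> (- 1 / 2) * ?\<mu> ^ card (C i) + 1" by simp
    have "q ^ k \<le> ?\<mu> ^ k" using \<mu> p(1) by (intro power_mono) auto
    then show "(- 1 / 2) * ?\<mu> ^ card (C i) + 1 \<le> exp (- (q ^ k / 2))"
      using exp_ge_add_one_self[of "- (q ^ k / 2)"] assms(5)[OF i] by simp
  qed
  also have "(\<Prod>i\<in>I. exp (- (q ^ k / 2))) = exp (- (card I * q ^ k / 2))"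
    by (simp add: exp_of_nat_mult[symmetric])
  finally show ?thesis by simp
qed

section \<open>The number of odd vertices\<close>

text \<open>This is -1 to the degree of \<open>v\<close>, written as a product over edges so that
  independence applies.\<close>

definition parity_sign :: "'a set \<Rightarrow> ('a set \<Rightarrow> bool) \<Rightarrow> 'a \<Rightarrow> real" where
  "parity_sign V X v = (\<Prod>e\<in>{e \<in> all_edges V. v \<in> e}. if X e then - 1 else 1)"

lemma parity_sign_eq:
  assumes "finite V" "v \<in> V"
  shows "parity_sign V X v = (if v \<in> odd_vertices V {e \<in> all_edges V. X e} then - 1 else 1)"
proof -
  have "parity_sign V X v = (- 1) ^ card ({e \<in> all_edges V. v \<in> e} \<inter> {e. X e})"
    unfolding parity_sign_def using finite_all_edges[OF assms(1)] by (simp add: prod.If_cases)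
  also have "{e \<in> all_edges V. v \<in> e} \<inter> {e. X e} = {e \<in> {e \<in> all_edges V. X e}. v \<in> e}" by auto
  also have "(- 1 :: real) ^ card {e \<in> {e \<in> all_edges V. X e}. v \<in> e} =
      (if v \<in> odd_vertices V {e \<in> all_edges V. X e} then - 1 else 1)"
    using assms(2) by (simp add: odd_vertices_def deg_def)
  finally show ?thesis .
qed

definition cut_edges :: "'a set \<Rightarrow> 'a set \<Rightarrow> 'a set set" where
  "cut_edges V S = {e \<in> all_edges V. odd (card (e \<inter> S))}"

text \<open>Exchange the two products: an edge with both ends in \<open>S\<close> contributes a
  square and disappears, so only edges with exactly one end in \<open>S\<close> remain.\<close>

lemma prod_parity_sign:
  assumes "finite V" "S \<subseteq> V"
  shows "(\<Prod>v\<in>S. parity_sign V X v) = (\<Prod>e\<in>cut_edges V S. if X e then - 1 else 1)"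
proof -
  have fin: "finite S" "finite (all_edges V)"
    using assms finite_subset finite_all_edges by blast+
  let ?\<sigma> = "\<lambda>e. if X e then - 1 else 1 :: real"
  have "(\<Prod>v\<in>S. parity_sign V X v) = (\<Prod>v\<in>S. \<Prod>e\<in>all_edges V. if v \<in> e then ?\<sigma> e else 1)"
    unfolding parity_sign_def using fin by (simp add: prod.inter_filter)
  also have "\<dots> = (\<Prod>e\<in>all_edges V. \<Prod>v\<in>S. if v \<in> e then ?\<sigma> e else 1)"
    by (rule prod.swap)
  also have "\<dots> = (\<Prod>e\<in>all_edges V. ?\<sigma> e ^ card (e \<inter> S))"
    using fin by (intro prod.cong refl) (simp add: prod.If_cases Int_commute Int_def)
  also have "\<dots> = (\<Prod>e\<in>all_edges V. if odd (card (e \<inter> S)) then ?\<sigma> e else 1)"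
    by (intro prod.cong refl) auto
  also have "\<dots> = (\<Prod>e\<in>cut_edges V S. ?\<sigma> e)"
    unfolding cut_edges_def using fin by (simp add: prod.If_cases Int_def)
  finally show ?thesis .
qed

text \<open>Every pair from \<open>S\<close> and its complement is a cut edge, and
  \<open>(a + 1) * (b + 1)\<close> is at least \<open>a + b + 1\<close>.\<close>

lemma card_cut_edges:
  assumes "finite V" "S \<subseteq> V" "S \<noteq> {}" "S \<noteq> V"
  shows "card V - 1 \<le> card (cut_edges V S)"
proof -
  have fin: "finite S" "finite (V - S)" using assms finite_subset by blast+
  have pos: "card S \<ge> 1" "card (V - S) \<ge> 1"
    using assms fin by (auto simp: Suc_le_eq card_gt_0_iff)
  have "card V = card S + card (V - S)"
    using assms fin card_mono[OF assms(1,2)] by (simp add: card_Diff_subset)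
  moreover obtain a b where "card S = Suc a" "card (V - S) = Suc b"
    using pos by (metis Suc_le_D One_nat_def)
  ultimately have "card V - 1 \<le> card (S \<times> (V - S))"
    by (simp add: card_cartesian_product)
  also have "\<dots> \<le> card (cut_edges V S)"
  proof (rule card_inj_on_le[where f = "\<lambda>(u, v). {u, v}"])
    show "inj_on (\<lambda>(u, v). {u, v}) (S \<times> (V - S))"
      by (auto simp: inj_on_def doubleton_eq_iff)
    show "(\<lambda>(u, v). {u, v}) ` (S \<times> (V - S)) \<subseteq> cut_edges V S"
    proof safe
      fix u v assume uv: "u \<in> S" "v \<in> V" "v \<notin> S"
      then have "{u, v} \<inter> S = {u}" by auto
      then show "{u, v} \<in> cut_edges V S"
        using uv assms(2) by (auto simp: cut_edges_def doubleton_in_all_edges)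
    qed
    show "finite (cut_edges V S)"
      using finite_all_edges[OF assms(1)] by (simp add: cut_edges_def)
  qed
  finally show ?thesis .
qed

text \<open>
  Expanding the product turns the generating function into a sum over \<open>S\<close> of the expected product
  of the signs in \<open>S\<close>, and this is \<open>(1 - 2p)\<close> to the number of edges in the cut of \<open>S\<close>.
\<close>

lemma expectation_parity_le:
  assumes "finite V" "V \<noteq> {}" "0 \<le> q" "q \<le> p" "p \<le> 1 - q" "\<bar>t\<bar> \<le> 1"
  shows "measure_pmf.expectation (edge_vars (all_edges V) p) (\<lambda>X. \<Prod>v\<in>V. t * parity_sign V X v + 1)
    \<le> 2 + (1 - 2 * q) ^ (card V - 1) * (1 + \<bar>t\<bar>) ^ card V"
proof -
  let ?E = "measure_pmf.expectation (edge_vars (all_edges V) p)"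
  let ?\<delta> = "(1 - 2 * q) ^ (card V - 1)"
  have fin: "finite (all_edges V)" using assms(1) finite_all_edges by blast
  have q: "q \<le> 1 / 2" using assms by simp
  have term_eq: "?E (\<lambda>X. \<Prod>v\<in>S. t * parity_sign V X v) = t ^ card S * (1 - 2 * p) ^ card (cut_edges V S)"
    if "S \<subseteq> V" for S
  proof -
    have "?E (\<lambda>X. \<Prod>v\<in>S. t * parity_sign V X v) =
        t ^ card S * ?E (\<lambda>X. \<Prod>e\<in>cut_edges V S. if X e then - 1 else 1)"
      using prod_parity_sign[OF assms(1) that] by (simp add: prod.distrib)
    also have "?E (\<lambda>X. \<Prod>e\<in>cut_edges V S. if X e then - 1 else 1) = (1 - 2 * p) ^ card (cut_edges V S)"
      using expectation_prod_edge_vars[OF fin, of "cut_edges V S" p "\<lambda>x. if x then - 1 else 1"] assms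
      by (auto simp: cut_edges_def algebra_simps)
    finally show ?thesis .
  qed
  \<comment> \<open>The cuts of \<open>{}\<close> and \<open>V\<close> are empty and give no decay,
    so each of these terms is bounded by 1; together they form the summand 2. All other terms carry
    the small factor \<open>?\<delta>\<close>.\<close>
  have term_le: "t ^ card S * (1 - 2 * p) ^ card (cut_edges V S) \<le>
      of_bool (S = {}) + of_bool (S = V) + ?\<delta> * \<bar>t\<bar> ^ card S" if S: "S \<subseteq> V" for S
  proof (cases "S = {} \<or> S = V")
    case True
    have "\<bar>t ^ card S * (1 - 2 * p) ^ card (cut_edges V S)\<bar> \<le> 1"
      unfolding abs_mult power_abs using assms by (intro mult_le_one power_le_one) auto
    moreover have "0 \<le> ?\<delta> * \<bar>t\<bar> ^ card S" using q by simp
    ultimately show ?thesis using True assms(2) by auto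
  next
    case False
    have "\<bar>t ^ card S * (1 - 2 * p) ^ card (cut_edges V S)\<bar> =
        \<bar>t\<bar> ^ card S * \<bar>1 - 2 * p\<bar> ^ card (cut_edges V S)"
      by (simp add: abs_mult power_abs)
    also have "\<bar>1 - 2 * p\<bar> ^ card (cut_edges V S) \<le> \<bar>1 - 2 * p\<bar> ^ (card V - 1)"
      using card_cut_edges[OF assms(1) S] False assms by (intro power_decreasing) auto
    also have "\<dots> \<le> ?\<delta>" using assms by (intro power_mono) auto
    finally show ?thesis using False by (simp add: mult.commute mult_right_mono)
  qed
  have "?E (\<lambda>X. \<Prod>v\<in>V. t * parity_sign V X v + 1) = ?E (\<lambda>X. \<Sum>S\<in>Pow V. \<Prod>v\<in>S. t * parity_sign V X v)"
    using prod_add[OF assms(1), of _ "\<lambda>_. 1::real"] by simp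
  also have "\<dots> = (\<Sum>S\<in>Pow V. t ^ card S * (1 - 2 * p) ^ card (cut_edges V S))"
    using term_eq by (subst Bochner_Integration.integral_sum) (auto intro: integrable_edge_vars[OF fin])
  also have "\<dots> \<le> (\<Sum>S\<in>Pow V. of_bool (S = {}) + of_bool (S = V) + ?\<delta> * \<bar>t\<bar> ^ card S)"
    using term_le by (intro sum_mono) auto
  also have "\<dots> = 2 + ?\<delta> * (\<Sum>S\<in>Pow V. \<bar>t\<bar> ^ card S)"
    using assms(1) by (simp add: sum.distrib sum_distrib_left of_bool_def sum.delta)
  also have "(\<Sum>S\<in>Pow V. \<bar>t\<bar> ^ card S) = (1 + \<bar>t\<bar>) ^ card V"
    using prod_add[OF assms(1), of "\<lambda>_. \<bar>t\<bar>" "\<lambda>_. 1"] by (simp add: add.commute)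
  finally show ?thesis .
qed

text \<open>An exponential moment argument with parameter \<open>1 / sqrt n\<close>, where
  \<open>\<epsilon>\<close> selects the tail. The expectation is at most 3, since
  \<open>large\<close> bounds the contribution of nontrivial cuts by 1, while on the event the
  product is at least \<open>exp (D / (2 * sqrt n)) / 2\<close>.\<close>

lemma prob_unbalanced:
  assumes "finite V" "card V = n" "n > 0" "0 \<le> q" "q \<le> p" "p \<le> 1 - q"
    and large: "sqrt n \<le> 2 * q * (real n - 1)" and "D \<ge> 0" "\<epsilon> = 1 \<or> \<epsilon> = -1"
  shows "measure_pmf.prob (edge_vars (all_edges V) p)
    {X. \<epsilon> * (n - 2 * real (card (odd_vertices V {e \<in> all_edges V. X e}))) \<ge> D} \<le> 6 * exp (- (D / (2 * sqrt n)))"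
    (is "measure_pmf.prob ?\<Omega> ?B \<le> _")
proof -
  let ?E = "measure_pmf.expectation ?\<Omega>"
  let ?G = "\<lambda>X. \<Prod>v\<in>V. \<epsilon> / sqrt n * parity_sign V X v + 1"
  let ?c = "exp (D / (2 * sqrt n)) / 2"
  define t where "t = 1 / sqrt n"
  have fin: "finite (all_edges V)" using assms(1) finite_all_edges by blast
  have t: "0 < t" "t \<le> 1" "n * t\<^sup>2 = 1" using assms(3) by (simp_all add: t_def power_divide)
  have lower: "?c \<le> ?G X" if "X \<in> ?B" for X
  proof -
    let ?O = "odd_vertices V {e \<in> all_edges V. X e}"
    \<comment> \<open>\<open>S\<close> collects the vertices with factor \<open>1 - t\<close>; on
      either tail it is the smaller parity class.\<close>
    define S where "S = (if \<epsilon> = 1 then ?O else V - ?O)"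
    have O: "?O \<subseteq> V" by (auto simp: odd_vertices_def)
    have finO: "finite ?O" using O assms(1) finite_subset by blast
    have cO: "card ?O \<le> n" using card_mono[OF assms(1) O] assms(2) by simp
    have S: "S \<subseteq> V" "real n - 2 * real (card S) \<ge> D"
      using that assms(2,9) O cO finO
      by (auto simp: S_def card_Diff_subset of_nat_diff)
    then have k: "2 * card S \<le> n" using assms(8) by linarith
    have finS: "finite S" using S assms(1) finite_subset by blast
    have "?G X = (\<Prod>v\<in>V. if v \<in> S then 1 - t else 1 + t)"
    proof (rule prod.cong[OF refl])
      fix v assume v: "v \<in> V"
      show "\<epsilon> / sqrt n * parity_sign V X v + 1 = (if v \<in> S then 1 - t else 1 + t)"
        using parity_sign_eq[OF assms(1) v, of X] assms(9) v by (auto simp: S_def t_def)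
    qed
    also have "\<dots> = (1 - t) ^ card S * (1 + t) ^ card (V - S)"
      using S(1) assms(1) by (simp add: prod.If_cases Int_absorb1 Diff_eq)
    also have "card (V - S) = card S + (n - 2 * card S)"
      using S(1) finS assms(2) k by (simp add: card_Diff_subset)
    \<comment> \<open>Each vertex of \<open>S\<close> is paired with one outside. As
      \<open>n * t\<^sup>2 = 1\<close>, the pairs cost at most a factor 2 by Bernoulli's inequality;
      the unpaired vertices, at least \<open>D\<close> of them, supply the exponential.\<close>
    also have "(1 - t) ^ card S * (1 + t) ^ (card S + (n - 2 * card S)) =
        (1 - t\<^sup>2) ^ card S * (1 + t) ^ (n - 2 * card S)"
      by (simp add: power_add power_mult_distrib[symmetric] power2_eq_square algebra_simps)
    also have "\<dots> \<ge> 1 / 2 * exp (D / (2 * sqrt n))"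
    proof (intro mult_mono)
      have "real (card S) * t\<^sup>2 \<le> n / 2 * t\<^sup>2" using k by (intro mult_right_mono) auto
      then have "1 / 2 \<le> 1 + real (card S) * (- t\<^sup>2)" using t(3) by simp
      also have "\<dots> \<le> (1 + (- t\<^sup>2)) ^ card S"
        by (rule Bernoulli_inequality) (use t in \<open>simp add: power_le_one\<close>)
      finally show "1 / 2 \<le> (1 - t\<^sup>2) ^ card S" by simp
      have "exp (t / 2) \<le> 1 + t / 2 + (t / 2)\<^sup>2" using t by (intro exp_bound) auto
      also have "\<dots> \<le> 1 + t" using t by (simp add: power2_eq_square field_simps)
      finally have "exp (t / 2) ^ (n - 2 * card S) \<le> (1 + t) ^ (n - 2 * card S)"
        by (intro power_mono) auto
      moreover have "exp (D / (2 * sqrt n)) \<le> exp (t / 2) ^ (n - 2 * card S)"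
      proof -
        have "D * (t / 2) \<le> real (n - 2 * card S) * (t / 2)"
          using S(2) k t(1) by (intro mult_right_mono) (auto simp: of_nat_diff)
        then show ?thesis by (simp add: exp_of_nat_mult[symmetric] t_def)
      qed
      ultimately show "exp (D / (2 * sqrt n)) \<le> (1 + t) ^ (n - 2 * card S)" by linarith
    qed (use t in \<open>auto simp: power_le_one\<close>)
    finally show ?thesis by simp
  qed
  have pos: "0 \<le> ?G X" for X
  proof (rule prod_nonneg)
    fix v assume "v \<in> V"
    then have "\<bar>parity_sign V X v\<bar> = 1" using parity_sign_eq[OF assms(1)] by auto
    then have "\<bar>\<epsilon> / sqrt n * parity_sign V X v\<bar> \<le> 1" using assms(9) t(2) by (auto simp: abs_mult t_def)
    then show "0 \<le> \<epsilon> / sqrt n * parity_sign V X v + 1" by linarith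
  qed
  have "measure_pmf.prob ?\<Omega> ?B * ?c = ?E (\<lambda>X. indicator ?B X * ?c)"
    by simp
  also have "\<dots> \<le> ?E ?G"
  proof (intro integral_mono integrable_edge_vars fin)
    fix X show "indicator ?B X * ?c \<le> ?G X"
      using lower[of X] pos[of X] by (cases "X \<in> ?B") simp_all
  qed
  also have "\<dots> \<le> 2 + (1 - 2 * q) ^ (card V - 1) * (1 + \<bar>\<epsilon> / sqrt n\<bar>) ^ card V"
    using assms t(2) by (intro expectation_parity_le) (auto simp: t_def)
  also have "(1 - 2 * q) ^ (card V - 1) * (1 + \<bar>\<epsilon> / sqrt n\<bar>) ^ card V \<le>
      exp (- (2 * q)) ^ (n - 1) * exp t ^ n"
  proof -
    have "\<bar>\<epsilon> / sqrt n\<bar> = t" using assms(9) by (auto simp: t_def)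
    moreover have "1 - 2 * q \<le> exp (- (2 * q))" "1 + t \<le> exp t"
      using exp_ge_add_one_self[of "- (2 * q)"] exp_ge_add_one_self[of t] by simp_all
    ultimately show ?thesis
      unfolding assms(2) using assms(4-6) t(1) by (intro mult_mono power_mono) auto
  qed
  also have "exp (- (2 * q)) ^ (n - 1) * exp t ^ n = exp (sqrt n - 2 * q * (real n - 1))"
    using assms(3) real_sqrt_mult_self[of "real n"]
    by (simp add: exp_of_nat_mult[symmetric] exp_add[symmetric] t_def of_nat_diff field_simps)
  also have "\<dots> \<le> 1" using large by simp
  finally have "measure_pmf.prob ?\<Omega> ?B * ?c \<le> 3" by simp
  then show ?thesis by (simp add: exp_minus field_simps)
qed

section \<open>The random graph is well spread\<close>

lemma prob_UN_le:
  fixes c :: real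
  assumes "finite I" "\<And>i. i \<in> I \<Longrightarrow> measure_pmf.prob M (B i) \<le> c"
  shows "measure_pmf.prob M (\<Union>i\<in>I. B i) \<le> card I * c"
proof -
  have "measure_pmf.prob M (\<Union>i\<in>I. B i) \<le> (\<Sum>i\<in>I. measure_pmf.prob M (B i))"
    using assms(1) by (intro measure_pmf.finite_measure_subadditive_finite) auto
  also have "\<dots> \<le> (\<Sum>i\<in>I. c)" by (rule sum_mono) (rule assms(2))
  finally show ?thesis by simp
qed

context
  fixes V :: "'a set" and n :: nat and p q :: real
  assumes finV: "finite V" and cardV: "card V = n" and n3: "3 \<le> n"
    and q: "0 \<le> q" "q \<le> p" "p \<le> 1 - q"
begin

abbreviation (input) "P \<equiv> measure_pmf.prob (edge_vars (all_edges V) p)"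

text \<open>Each edge inside \<open>S\<close> is a block of its own, and the event is that no block
  succeeds, so \<open>m = 0\<close>.\<close>

lemma prob_empty_subset:
  assumes "S \<subseteq> V"
  shows "P {X. \<forall>e\<in>all_edges S. X e \<noteq> b} \<le> exp (- (real (card S choose 2) * q / 2))"
proof -
  have finS: "finite S" using assms finV finite_subset by blast
  have "card (all_edges S) = card S choose 2"
    unfolding all_edges_def using n_subsets[OF finS] by simp
  moreover have "{X. \<forall>e\<in>all_edges S. X e \<noteq> b} =
      {X. card {e \<in> all_edges S. \<forall>e'\<in>{e}. X e' = b} \<le> 0}"
    using finite_all_edges[OF finS] by auto
  moreover have "P {X. card {e \<in> all_edges S. \<forall>e'\<in>{e}. X e' = b} \<le> 0} \<le>
      2 ^ 0 * exp (- (card (all_edges S) * q ^ 1 / 2))"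
  proof (rule prob_few_blocks)
    show "{e} \<subseteq> all_edges V" if "e \<in> all_edges S" for e
      using that assms by (auto simp: all_edges_def)
  qed (use finV finS q in \<open>auto simp: disjoint_family_on_def finite_all_edges\<close>)
  ultimately show ?thesis by simp
qed

text \<open>The block of \<open>w\<close> consists of its two edges to \<open>u\<close> and
  \<open>v\<close>, disjoint for distinct \<open>w\<close>. Fewer than three successes means at most
  two, whence the factor 4.\<close>

lemma prob_few_common_neighbours:
  assumes "u \<in> V" "v \<in> V" "u \<noteq> v"
  shows "P {X. card {w \<in> V. {u, w} \<in> {e \<in> all_edges V. X e = b} \<and> {v, w} \<in> {e \<in> all_edges V. X e = b}} < 3}
    \<le> 4 * exp (- ((real n - 2) * q\<^sup>2 / 2))"
proof -
  let ?I = "V - {u, v}"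
  let ?C = "\<lambda>w. {{u, w}, {v, w}}"
  have eq: "{w \<in> V. {u, w} \<in> {e \<in> all_edges V. X e = b} \<and> {v, w} \<in> {e \<in> all_edges V. X e = b}} =
      {w \<in> ?I. \<forall>e\<in>?C w. X e = b}" for X
    using assms by (auto simp: doubleton_in_all_edges)
  have "card ?I = n - 2" using assms finV cardV by (simp add: card_Diff_subset)
  moreover have "P {X. card {w \<in> ?I. \<forall>e\<in>?C w. X e = b} \<le> 2} \<le> 2 ^ 2 * exp (- (card ?I * q ^ 2 / 2))"
  proof (rule prob_few_blocks)
    show "disjoint_family_on ?C ?I"
      using assms by (auto simp: disjoint_family_on_def doubleton_eq_iff)
    show "card (?C i) = 2" if "i \<in> ?I" for i
      using assms that by (auto simp: doubleton_eq_iff)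
  qed (use assms finV q in \<open>auto simp: doubleton_in_all_edges finite_all_edges\<close>)
  ultimately show ?thesis unfolding eq using n3 by (simp add: of_nat_diff less_Suc_eq_le numeral_3_eq_3 numeral_2_eq_2)
qed

text \<open>The edges at \<open>u\<close> are single-edge blocks. The factor \<open>2 ^ m\<close> is
  affordable because \<open>m\<close> will be of order \<open>sqrt n\<close>, below the order of
  \<open>n * q\<close>.\<close>

lemma prob_small_degree:
  assumes "u \<in> V"
  shows "P {X. deg {e \<in> all_edges V. X e} u \<le> m} \<le> 2 ^ m * exp (- ((real n - 1) * q / 2))"
proof -
  let ?I = "V - {u}"
  have "{X. deg {e \<in> all_edges V. X e} u \<le> m} \<subseteq> {X. card {w \<in> ?I. \<forall>e\<in>{{u, w}}. X e = True} \<le> m}"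
  proof safe
    fix X assume m: "deg {e \<in> all_edges V. X e} u \<le> m"
    have "card {w \<in> ?I. \<forall>e\<in>{{u, w}}. X e = True} \<le> deg {e \<in> all_edges V. X e} u"
      using assms finite_all_edges[OF finV]
      by (intro card_le_deg) (auto simp: doubleton_in_all_edges)
    then show "card {w \<in> ?I. \<forall>e\<in>{{u, w}}. X e = True} \<le> m" using m by linarith
  qed
  then have "P {X. deg {e \<in> all_edges V. X e} u \<le> m} \<le> P {X. card {w \<in> ?I. \<forall>e\<in>{{u, w}}. X e = True} \<le> m}"
    by (intro measure_pmf.finite_measure_mono) auto
  also have "\<dots> \<le> 2 ^ m * exp (- (card ?I * q ^ 1 / 2))"
  proof (rule prob_few_blocks)
    show "disjoint_family_on (\<lambda>w. {{u, w}}) ?I"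
      by (auto simp: disjoint_family_on_def doubleton_eq_iff)
  qed (use assms finV q in \<open>auto simp: doubleton_in_all_edges finite_all_edges\<close>)
  also have "card ?I = n - 1" using assms finV cardV by simp
  finally show ?thesis using n3 by (simp add: of_nat_diff)
qed

lemma prob_not_well_spread:
  "P {X. \<not> well_spread s V {e \<in> all_edges V. X e = b}} \<le>
    real n ^ s * exp (- (real (s choose 2) * q / 2)) + 4 * (real n)\<^sup>2 * exp (- ((real n - 2) * q\<^sup>2 / 2))"
proof -
  let ?A = "\<Union>S\<in>{S. S \<subseteq> V \<and> card S = s}. {X. \<forall>e\<in>all_edges S. X e \<noteq> b}"
  let ?few = "\<lambda>(u, v). {X. card {w \<in> V. {u, w} \<in> {e \<in> all_edges V. X e = b} \<and> {v, w} \<in> {e \<in> all_edges V. X e = b}} < 3}"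
  let ?D = "{(u, v). u \<in> V \<and> v \<in> V \<and> u \<noteq> v}"
  have DV: "?D \<subseteq> V \<times> V" by auto
  then have finD: "finite ?D" using finV by (meson finite_SigmaI finite_subset)
  have fin: "finite {S. S \<subseteq> V \<and> card S = s}" using finV by simp
  have "{X. \<not> well_spread s V {e \<in> all_edges V. X e = b}} \<subseteq> ?A \<union> (\<Union>z\<in>?D. ?few z)"
  proof
    fix X assume "X \<in> {X. \<not> well_spread s V {e \<in> all_edges V. X e = b}}"
    then have "\<not> well_spread s V {e \<in> all_edges V. X e = b}" by simp
    then show "X \<in> ?A \<union> (\<Union>z\<in>?D. ?few z)"
      unfolding well_spread_def de_Morgan_conj
    proof (elim disjE)
      assume "\<not> (\<forall>S. S \<subseteq> V \<and> card S = s \<longrightarrow> (\<exists>e\<in>{e \<in> all_edges V. X e = b}. e \<subseteq> S))"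
      then obtain S where S: "S \<subseteq> V" "card S = s"
        and none: "\<forall>e\<in>{e \<in> all_edges V. X e = b}. \<not> e \<subseteq> S" by auto
      have "\<forall>e\<in>all_edges S. X e \<noteq> b"
        using none S(1) unfolding all_edges_def by blast
      then have "X \<in> ?A" using S by auto
      then show ?thesis by (rule UnI1)
    next
      assume "\<not> (\<forall>u\<in>V. \<forall>v\<in>V. u \<noteq> v \<longrightarrow> 3 \<le> card {w \<in> V.
        {u, w} \<in> {e \<in> all_edges V. X e = b} \<and> {v, w} \<in> {e \<in> all_edges V. X e = b}})"
      then obtain u v where uv: "u \<in> V" "v \<in> V" "u \<noteq> v" "\<not> 3 \<le> card {w \<in> V.
        {u, w} \<in> {e \<in> all_edges V. X e = b} \<and> {v, w} \<in> {e \<in> all_edges V. X e = b}}"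
        by blast
      then have "(u, v) \<in> ?D" "X \<in> ?few (u, v)" by (simp_all add: not_le)
      then show ?thesis by (intro UnI2 UN_I)
    qed
  qed
  then have "P {X. \<not> well_spread s V {e \<in> all_edges V. X e = b}} \<le> P (?A \<union> (\<Union>z\<in>?D. ?few z))"
    by (intro measure_pmf.finite_measure_mono) auto
  also have "\<dots> \<le> P ?A + P (\<Union>z\<in>?D. ?few z)"
    by (intro measure_Un_le) auto
  also have "P ?A \<le> card {S. S \<subseteq> V \<and> card S = s} * exp (- (real (s choose 2) * q / 2))"
    using prob_empty_subset by (intro prob_UN_le[OF fin]) auto
  also have "card {S. S \<subseteq> V \<and> card S = s} = n choose s"
    using n_subsets[OF finV] cardV by simp
  also have "real (n choose s) * exp (- (real (s choose 2) * q / 2)) \<le> real n ^ s * exp (- (real (s choose 2) * q / 2))"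
  proof (intro mult_right_mono)
    have "n choose s \<le> n ^ s" by (cases "s \<le> n") (simp_all add: binomial_le_pow binomial_eq_0)
    then show "real (n choose s) \<le> real n ^ s" unfolding of_nat_power[symmetric] of_nat_le_iff .
  qed simp
  also have "P (\<Union>z\<in>?D. ?few z) \<le> card ?D * (4 * exp (- ((real n - 2) * q\<^sup>2 / 2)))"
    using prob_few_common_neighbours by (intro prob_UN_le[OF finD]) auto
  also have "card ?D * (4 * exp (- ((real n - 2) * q\<^sup>2 / 2))) \<le> (real n)\<^sup>2 * (4 * exp (- ((real n - 2) * q\<^sup>2 / 2)))"
  proof (intro mult_right_mono)
    have "card ?D \<le> card (V \<times> V)" using finV DV by (intro card_mono) auto
    then have "card ?D \<le> n\<^sup>2" by (simp add: card_cartesian_product cardV power2_eq_square)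
    then show "real (card ?D) \<le> (real n)\<^sup>2" unfolding of_nat_power[symmetric] of_nat_le_iff .
  qed simp
  finally show ?thesis by simp
qed

lemma prob_exists_small_degree:
  "P {X. \<exists>u\<in>V. deg {e \<in> all_edges V. X e} u \<le> m} \<le> real n * (2 ^ m * exp (- ((real n - 1) * q / 2)))"
proof -
  have "{X. \<exists>u\<in>V. deg {e \<in> all_edges V. X e} u \<le> m} = (\<Union>u\<in>V. {X. deg {e \<in> all_edges V. X e} u \<le> m})"
    by auto
  then show ?thesis using prob_UN_le[OF finV prob_small_degree] cardV by simp
qed

end

section \<open>All required properties at once, and the event that they imply\<close>

definition nice_graph :: "nat \<Rightarrow> real \<Rightarrow> 'a set \<Rightarrow> 'a set set \<Rightarrow> bool" where
  "nice_graph s D V E \<longleftrightarrow>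
     well_spread s V E \<and> well_spread s V (all_edges V - E) \<and> (\<forall>u\<in>V. 3 * s + 5 \<le> deg E u) \<and>
     \<bar>card V - 2 * real (card (odd_vertices V E))\<bar> < D"

text \<open>A union bound over five failures: spreading of the graph, spreading of its complement, a
  small degree, and the two tails of the number of odd vertices. The doubled failures explain the
  coefficients 2, 8 and 12.\<close>

lemma prob_not_nice_graph:
  assumes "finite V" "card V = n" "3 \<le> n" "0 \<le> q" "q \<le> p" "p \<le> 1 - q"
    and "sqrt n \<le> 2 * q * (real n - 1)" "D \<ge> 0"
  shows "measure_pmf.prob (edge_vars (all_edges V) p) {X. \<not> nice_graph s D V {e \<in> all_edges V. X e}} \<le>
    2 * real n ^ s * exp (- (real (s choose 2) * q / 2)) + 8 * (real n)\<^sup>2 * exp (- ((real n - 2) * q\<^sup>2 / 2))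
    + real n * 2 ^ (3 * s + 4) * exp (- ((real n - 1) * q / 2)) + 12 * exp (- (D / (2 * sqrt n)))"
proof -
  let ?P = "measure_pmf.prob (edge_vars (all_edges V) p)"
  let ?W = "\<lambda>b. {X. \<not> well_spread s V {e \<in> all_edges V. X e = b}}"
  let ?G = "{X. \<exists>u\<in>V. deg {e \<in> all_edges V. X e} u \<le> 3 * s + 4}"
  let ?U = "\<lambda>\<epsilon>. {X. \<epsilon> * (n - 2 * real (card (odd_vertices V {e \<in> all_edges V. X e}))) \<ge> D}"
  have compl: "all_edges V - {e \<in> all_edges V. X e} = {e \<in> all_edges V. X e = False}" for X
    by auto
  have "{X. \<not> nice_graph s D V {e \<in> all_edges V. X e}} \<subseteq> (?W True \<union> ?W False) \<union> ?G \<union> (?U 1 \<union> ?U (-1))"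
    unfolding nice_graph_def compl using assms(2) by (fastforce simp: not_le abs_less_iff)
  then have "?P {X. \<not> nice_graph s D V {e \<in> all_edges V. X e}} \<le>
      ?P ((?W True \<union> ?W False) \<union> ?G \<union> (?U 1 \<union> ?U (-1)))"
    by (intro measure_pmf.finite_measure_mono) auto
  also have "\<dots> \<le> ?P ((?W True \<union> ?W False) \<union> ?G) + ?P (?U 1 \<union> ?U (-1))"
    by (intro measure_Un_le) auto
  also have "?P ((?W True \<union> ?W False) \<union> ?G) \<le> ?P (?W True \<union> ?W False) + ?P ?G"
    by (intro measure_Un_le) auto
  also have "?P (?W True \<union> ?W False) \<le> ?P (?W True) + ?P (?W False)"
    by (intro measure_Un_le) auto
  also have "?P (?U 1 \<union> ?U (-1)) \<le> ?P (?U 1) + ?P (?U (-1))"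
    by (intro measure_Un_le) auto
  finally show ?thesis
    using prob_not_well_spread[OF assms(1-6), of s True] prob_not_well_spread[OF assms(1-6), of s False]
      prob_exists_small_degree[OF assms(1-6), of "3 * s + 4"]
      prob_unbalanced[OF assms(1,2) _ assms(4-8), of 1] prob_unbalanced[OF assms(1,2) _ assms(4-8), of "-1"] assms(3)
    by (simp add: algebra_simps)
qed

text \<open>Half the number of odd vertices is within \<open>D / 4\<close> of \<open>n / 4\<close>,
  and the three numbers exceed that half by at most \<open>s\<close>; so \<open>D / 4 + s\<close> is
  the total error.\<close>

lemma nice_graph_E_edit:
  assumes "3 \<le> n" "E \<subseteq> all_edges {1..n}" "nice_graph s D {1..n} E"
    and "D + 4 * real s \<le> 4 * real n powr (1 / 2 + \<eta>)"
  shows "E \<in> E_edit \<eta> n"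
proof -
  have nice: "well_spread s {1..n} E" "well_spread s {1..n} (all_edges {1..n} - E)"
    "\<And>v. v \<in> {1..n} \<Longrightarrow> 3 * s + 5 \<le> deg E v"
    "\<bar>n - 2 * real (card (odd_vertices {1..n} E))\<bar> < D"
    using assms(3) by (auto simp: nice_graph_def)
  have ne: "{1..n} \<noteq> {}" using assms(1) by auto
  note bounds = eulerian_numbers_bounds[OF finite_atLeastAtMost ne assms(2) nice(1-3)]
  have "near_quarter \<eta> n k" if "k \<in> {N_edit {1..n} E, N_ext {1..n} E, N_red {1..n} E}" for k
  proof -
    have "real (card (odd_vertices {1..n} E)) \<le> 2 * real k"
      "2 * real k \<le> real (card (odd_vertices {1..n} E)) + 2 * real s"
      using bspec[OF bounds(3) that] by linarith+
    then show ?thesis using nice(4) assms(4) unfolding near_quarter_def by linarith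
  qed
  then show ?thesis using bounds(1,2) by (simp add: E_edit_def)
qed

section \<open>Asymptotics\<close>

lemma of_nat_choose_two: "real (s choose 2) = real s * (real s - 1) / 2"
  by (induction s) (auto simp: numeral_2_eq_2 field_simps)

text \<open>The assumptions \<open>b\<close> are inequalities in \<open>n\<close> alone, free of
  \<open>p\<close> and \<open>s\<close>, to be verified asymptotically. \<open>D\<close> is half of
  what the window allows, leaving room for \<open>s\<close>, and each of the four failure terms gets
  a quarter of the permitted probability.\<close>

lemma prob_E_edit:
  fixes \<eta> r p :: real and n :: nat
  defines "q \<equiv> (ln (real n))\<^sup>2 / sqrt (real n)"
  defines "D \<equiv> 2 * real n powr (1 / 2 + \<eta>)"
  assumes n3: "3 \<le> n" and p: "q \<le> p" "p \<le> 1 - q"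
    and b: "sqrt n \<le> 2 * q * (real n - 1)"
      "D + 4 * (sqrt n + 1) \<le> 4 * real n powr (1 / 2 + \<eta>)"
      "ln n \<le> (sqrt n - 1) * q / 4"
      "2 * exp (sqrt n * (ln n - (sqrt n - 1) * q / 4)) \<le> 1 / 4 * (1 / real n powr r)"
      "8 * (real n)\<^sup>2 * exp (- ((real n - 2) * q\<^sup>2 / 2)) \<le> 1 / 4 * (1 / real n powr r)"
      "real n * 2 powr (3 * sqrt n + 7) * exp (- ((real n - 1) * q / 2)) \<le> 1 / 4 * (1 / real n powr r)"
      "12 * exp (- (D / (2 * sqrt n))) \<le> 1 / 4 * (1 / real n powr r)"
  shows "measure_pmf.prob (gnp n p) (E_edit \<eta> n) \<ge> 1 - 1 / real n powr r"
proof -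
  define s where "s = nat \<lceil>sqrt n\<rceil>"
  define V where "V = {1..n}"
  have q0: "0 \<le> q" by (simp add: q_def)
  have s: "sqrt n \<le> s" "s \<le> sqrt n + 1"
    using of_nat_ceiling[of "sqrt n"] of_int_ceiling_le_add_one[of "sqrt n"]
    by (simp_all add: s_def)
  let ?P = "measure_pmf.prob (edge_vars (all_edges V) p)"
  have "?P {X. \<not> nice_graph s D V {e \<in> all_edges V. X e}} \<le>
    2 * real n ^ s * exp (- (real (s choose 2) * q / 2)) + 8 * (real n)\<^sup>2 * exp (- ((real n - 2) * q\<^sup>2 / 2))
    + real n * 2 ^ (3 * s + 4) * exp (- ((real n - 1) * q / 2)) + 12 * exp (- (D / (2 * sqrt n)))"
    using b n3 q0 p by (intro prob_not_nice_graph) (auto simp: V_def q_def D_def)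
  also have "2 * real n ^ s * exp (- (real (s choose 2) * q / 2)) \<le>
      2 * exp (sqrt n * (ln n - (sqrt n - 1) * q / 4))"
  proof -
    have "real n ^ s * exp (- (real (s choose 2) * q / 2)) = exp (s * (ln n - (real s - 1) * q / 4))"
    proof -
      have "real n ^ s = exp (s * ln n)" using n3 by (simp add: exp_of_nat_mult)
      then show ?thesis
        unfolding of_nat_choose_two by (simp add: exp_add[symmetric] algebra_simps)
    qed
    also have "s * (ln n - (real s - 1) * q / 4) \<le> s * (ln n - (sqrt n - 1) * q / 4)"
      using s(1) q0 by (intro mult_left_mono diff_left_mono divide_right_mono mult_right_mono) auto
    \<comment> \<open>The bracket is nonpositive by the third inequality in \<open>b\<close>, so
      replacing the outer \<open>s\<close> by the smaller \<open>sqrt n\<close> increases the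
      product.\<close>
    also have "s * (ln n - (sqrt n - 1) * q / 4) \<le> sqrt n * (ln n - (sqrt n - 1) * q / 4)"
      using s(1) b by (intro mult_right_mono_neg) auto
    finally show ?thesis by simp
  qed
  also have "real n * 2 ^ (3 * s + 4) * exp (- ((real n - 1) * q / 2)) \<le>
      real n * 2 powr (3 * sqrt n + 7) * exp (- ((real n - 1) * q / 2))"
  proof (intro mult_right_mono mult_left_mono)
    have "(2::real) ^ (3 * s + 4) = 2 powr (3 * s + 4)" 
      using powr_realpow[of 2 "3 * s + 4"] by simp
    \<comment> \<open>From \<open>s \<le> sqrt n + 1\<close> the exponent is at most
      \<open>3 * (sqrt n + 1) + 4\<close>.\<close>
    also have "\<dots> \<le> 2 powr (3 * sqrt n + 7)" using s(2) by (intro powr_mono) auto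
    finally show "(2::real) ^ (3 * s + 4) \<le> 2 powr (3 * sqrt n + 7)" .
  qed auto
  finally have bad: "?P {X. \<not> nice_graph s D V {e \<in> all_edges V. X e}} \<le> 1 / real n powr r"
    using b by linarith
  have "1 - 1 / real n powr r \<le> ?P {X. nice_graph s D V {e \<in> all_edges V. X e}}"
  proof -
    have "- {X. nice_graph s D V {e \<in> all_edges V. X e}} = {X. \<not> nice_graph s D V {e \<in> all_edges V. X e}}"
      by auto
    then show ?thesis
      using bad measure_pmf.prob_compl[of "{X. nice_graph s D V {e \<in> all_edges V. X e}}" "edge_vars (all_edges V) p"]
      by (simp add: Compl_eq_Diff_UNIV[symmetric])
  qed
  also have "\<dots> \<le> ?P ((\<lambda>X. {e \<in> all_edges V. X e}) -` E_edit \<eta> n)"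
  proof (intro measure_pmf.finite_measure_mono subsetI)
    fix X assume "X \<in> {X. nice_graph s D V {e \<in> all_edges V. X e}}"
    then have "{e \<in> all_edges V. X e} \<in> E_edit \<eta> n"
      using b s(2) by (intro nice_graph_E_edit[OF n3, of _ s D]) (auto simp: V_def)
    then show "X \<in> (\<lambda>X. {e \<in> all_edges V. X e}) -` E_edit \<eta> n" by simp
  qed auto
  also have "\<dots> = measure_pmf.prob (gnp n p) (E_edit \<eta> n)"
    by (simp add: gnp_def edge_vars_def V_def)
  finally show ?thesis .
qed

theorem theorem1:
  fixes \<eta> r :: real
  assumes "\<eta> > 0" and "r > 0"
  shows "\<exists>n0::nat. n0 \<ge> 1 \<and> (\<forall>n\<ge>n0. \<forall>p::real.
           (ln (real n))\<^sup>2 / sqrt (real n) \<le> p \<longrightarrow>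
           p \<le> 1 - (ln (real n))\<^sup>2 / sqrt (real n) \<longrightarrow>
           measure_pmf.prob (gnp n p) (E_edit \<eta> n) \<ge> 1 - 1 / real n powr r)"
proof -
  \<comment> \<open>For this \<open>q\<close>, \<open>sqrt n * q\<close> is
    \<open>(ln n)\<^sup>2\<close>, \<open>n * q\<close> is \<open>sqrt n * (ln n)\<^sup>2\<close>
    and \<open>n * q\<^sup>2\<close> is \<open>(ln n) ^ 4\<close>. These beat, respectively, the
    \<open>ln n\<close> from counting sets of size \<open>s\<close>, the exponent
    \<open>3 * sqrt n\<close> from the degrees, and any multiple of \<open>ln n\<close>.\<close>
  let ?q = "\<lambda>n::nat. (ln (real n))\<^sup>2 / sqrt (real n)"
  have "\<forall>\<^sub>F n::nat in sequentially. 3 \<le> n" by (rule eventually_ge_at_top)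
  moreover have "\<forall>\<^sub>F n::nat in sequentially. sqrt n \<le> 2 * ?q n * (real n - 1)"
    by real_asymp
  moreover have "\<forall>\<^sub>F n::nat in sequentially.
      2 * real n powr (1 / 2 + \<eta>) + 4 * (sqrt n + 1) \<le> 4 * real n powr (1 / 2 + \<eta>)"
    using assms by real_asymp
  moreover have "\<forall>\<^sub>F n::nat in sequentially. ln n \<le> (sqrt n - 1) * ?q n / 4"
    by real_asymp
  moreover have "\<forall>\<^sub>F n::nat in sequentially.
      2 * exp (sqrt n * (ln n - (sqrt n - 1) * ?q n / 4)) \<le> 1 / 4 * (1 / real n powr r)"
    using assms by real_asymp
  moreover have "\<forall>\<^sub>F n::nat in sequentially.
      8 * (real n)\<^sup>2 * exp (- ((real n - 2) * (?q n)\<^sup>2 / 2)) \<le> 1 / 4 * (1 / real n powr r)"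
    using assms by real_asymp
  moreover have "\<forall>\<^sub>F n::nat in sequentially.
      real n * 2 powr (3 * sqrt n + 7) * exp (- ((real n - 1) * ?q n / 2)) \<le> 1 / 4 * (1 / real n powr r)"
    using assms by real_asymp
  \<comment> \<open>The exponent is \<open>- (n powr \<eta>)\<close>, which decays faster than any
    power of \<open>n\<close> because \<open>\<eta> > 0\<close>.\<close>
  moreover have "\<forall>\<^sub>F n::nat in sequentially.
      12 * exp (- (2 * real n powr (1 / 2 + \<eta>) / (2 * sqrt n))) \<le> 1 / 4 * (1 / real n powr r)"
    using assms by real_asymp
  ultimately have "\<forall>\<^sub>F n::nat in sequentially. \<forall>p. ?q n \<le> p \<longrightarrow> p \<le> 1 - ?q n \<longrightarrow>
      measure_pmf.prob (gnp n p) (E_edit \<eta> n) \<ge> 1 - 1 / real n powr r"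
    by eventually_elim (intro allI impI prob_E_edit; assumption)
  then obtain N where "\<forall>n\<ge>N. \<forall>p. ?q n \<le> p \<longrightarrow> p \<le> 1 - ?q n \<longrightarrow>
      measure_pmf.prob (gnp n p) (E_edit \<eta> n) \<ge> 1 - 1 / real n powr r"
    unfolding eventually_sequentially by blast
  then show ?thesis by (intro exI[of _ "max N 1"]) auto
qed

end
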